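(* Let $h$ be a function in the Nevanlinna class $N(\Pi)$ that is continuous on $\overline\Pi$. Assume that $t\mapsto \operatorname{Re}h(t)/(1+t^2)$ belongs to $L^1(\mathbb R)$, that $\operatorname{Re}h$ is even on $\mathbb R$, and that $h$ is bounded on $i\mathbb R\cap\overline\Pi$. Then there exist $\alpha,\beta\in\mathbb C$ such that $$h(z)=\alpha z+\beta+\frac1{\pi i}\int_{\mathbb R}\operatorname{Re}h(t)\Big(\frac1{t-z}-\frac t{t^2+1}\Big)\,dt\qquad\text{for all } z\in\Pi.$$
   Context: $\Pi=\{z\in\mathbb C:\operatorname{Im}z>0\}$ is the open upper half-plane and $\overline\Pi$ its closure in $\mathbb C$. The Nevanlinna class $N(\Pi)$ is the class of holomorphic functions $F$ on $\Pi$ such that $\log^+|F|$ has a harmonic majorant on $\Pi$. "$h$ continuous on $\overline\Pi$" means that $h$ extends continuously to $\overline\Pi$, the extension being denoted by the same letter. *)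

theory Defs
  imports "HOL-Analysis.Analysis"
begin

definition upper_half_plane :: "complex set" where
  "upper_half_plane = {z. Im z > 0}"

(* A C^2 function with vanishing Laplacian, in the coordinates z = x + i y. Here ux, uy are the
   first and uxx, uxy, uyx, uyy the second partial derivatives (uxy is the y-derivative of ux). *)
definition harmonic_on :: "(complex \<Rightarrow> real) \<Rightarrow> complex set \<Rightarrow> bool" where
  "harmonic_on u S \<longleftrightarrow> open S \<and>
     (\<exists>ux uy uxx uxy uyx uyy :: complex \<Rightarrow> real.
        (\<forall>z\<in>S. (u has_derivative (\<lambda>v. ux z * Re v + uy z * Im v)) (at z)) \<and>
        (\<forall>z\<in>S. (ux has_derivative (\<lambda>v. uxx z * Re v + uxy z * Im v)) (at z)) \<and>
        (\<forall>z\<in>S. (uy has_derivative (\<lambda>v. uyx z * Re v + uyy z * Im v)) (at z)) \<and>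
        continuous_on S uxx \<and> continuous_on S uxy \<and>
        continuous_on S uyx \<and> continuous_on S uyy \<and>
        (\<forall>z\<in>S. uxx z + uyy z = 0))"

(* Used for x \<ge> 0 only; log^+ 0 = 0 comes out right because ln 0 = 0. *)
definition log_plus :: "real \<Rightarrow> real" where
  "log_plus x = max 0 (ln x)"

(* Only the values of F on the half-plane matter. *)
definition nevanlinna_class :: "(complex \<Rightarrow> complex) set" where
  "nevanlinna_class =
     {F. F holomorphic_on upper_half_plane \<and>
         (\<exists>u. harmonic_on u upper_half_plane \<and>
              (\<forall>z\<in>upper_half_plane. log_plus (cmod (F z)) \<le> u z))}"

end

(* Let g be the Schwarz integral of Re h. The function h - g is holomorphic on the half-plane and its
   real part tends to 0 at the real axis, so it extends to an entire function f with
   f (cnj z) = - cnj (f z). A nonnegative harmonic function u on the half-plane satisfies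
   u z <= c Im z + o(|z|^2) / Im z by Harnack's inequality, where c = inf u / Im, and this bounds
   log |f| off the real axis. Damping f by exp (- 2 Q / (w - a) - 2 Q / (b - w)) on a square with two
   opposite vertices a, b on the real axis carries the bound across the axis: f has exponential type,
   and type zero along the real axis. As f (i y) = O(1 + |y|), Phragmen-Lindelof in quadrants and then
   in half-planes gives f z = O(1 + |z|), so f is affine by Liouville. *)

theory Submission
  imports Defs "HOL-Complex_Analysis.Complex_Analysis" "HOL-Probability.Sinc_Integral"
begin

section \<open>Harmonic functions on the half-plane\<close>

text \<open>The function \<open>\<i> * sin z\<close> shows where the difficulty lies: it is in the
  class, its real part vanishes on the real axis, and it is not affine; boundedness on the imaginary
  axis is what excludes it. So exponential type has to be allowed first and removed by
  Phragmen-Lindelof, which needs growth of type zero along the real axis. Just there the harmonic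
  majorant says little, as its bound contains \<open>(cmod z)\<^sup>2 / Im z\<close>, and continuity
  of \<open>h\<close> does not help, since the Schwarz integral of a continuous function need not
  extend continuously; only its real part does. This is why the extension across the axis is found
  by reflecting a primitive, and why the square has a diagonal on the axis: its sides meet the axis
  at angle pi/4, where the real distance to the vertex equals \<open>\<bar>Im w\<bar>\<close>, so
  that the damping cancels \<open>exp (Q / \<bar>Im w\<bar>)\<close>. The type is zero, and not
  merely finite, because \<open>c\<close> is an infimum: Harnack's inequality started from a point
  that nearly attains it makes the coefficient of \<open>(cmod z)\<^sup>2 / Im z\<close> as small as
  wanted.\<close>

text \<open>Symmetry of the mixed partials: both equal the limit of the same second difference.\<close>

lemma second_difference_mvt:
  fixes u ua uab :: "complex \<Rightarrow> real" and a b z :: complex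
  assumes "0 < s" and "cmod a \<le> 1" and "cmod b \<le> 1" and "2 * s < r"
    and ua: "\<And>w x. w + of_real x * a \<in> ball z r \<Longrightarrow>
      ((\<lambda>t. u (w + of_real t * a)) has_real_derivative ua (w + of_real x * a)) (at x)"
    and uab: "\<And>w x. w + of_real x * b \<in> ball z r \<Longrightarrow>
      ((\<lambda>t. ua (w + of_real t * b)) has_real_derivative uab (w + of_real x * b)) (at x)"
  shows "\<exists>w\<in>ball z r. u (z + s * a + s * b) - u (z + s * a) - u (z + s * b) + u z = s * s * uab w"
proof -
  have in_ball: "z + x * a + y * b \<in> ball z r" if "0 \<le> x" "x \<le> s" "0 \<le> y" "y \<le> s" for x y :: real
  proof -
    have "cmod (x * a + y * b) \<le> \<bar>x\<bar> * cmod a + \<bar>y\<bar> * cmod b"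
      using norm_triangle_ineq[of "x * a" "y * b"] by (simp add: norm_mult)
    also have "\<dots> \<le> s * 1 + s * 1"
      using that assms by (intro add_mono mult_mono) auto
    finally have "cmod (x * a + y * b) < r"
      using \<open>2 * s < r\<close> by simp
    moreover have "dist z (z + x * a + y * b) = cmod (x * a + y * b)"
      by (simp add: dist_norm norm_minus_commute add.assoc add.commute)
    ultimately show ?thesis
      by simp
  qed
  have "\<exists>x>0. x < s \<and> (u (z + s * b + s * a) - u (z + s * a)) - (u (z + s * b + of_real 0 * a) - u (z + of_real 0 * a))
      = (s - 0) * (ua (z + s * b + x * a) - ua (z + x * a))"
  proof (rule MVT2[OF \<open>0 < s\<close>])
    fix x assume x: "0 \<le> x" "x \<le> s"
    have 1: "z + s * b + x * a \<in> ball z r" "z + x * a \<in> ball z r"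
      using in_ball[of x s] in_ball[of x 0] x \<open>0 < s\<close> by (auto simp: algebra_simps)
    show "((\<lambda>x. u (z + s * b + of_real x * a) - u (z + of_real x * a)) has_real_derivative
        ua (z + s * b + x * a) - ua (z + x * a)) (at x)"
      using 1 by (intro DERIV_diff ua)
  qed
  then obtain x where x: "0 < x" "x < s"
    and ux: "u (z + s * b + s * a) - u (z + s * a) - (u (z + s * b) - u z)
      = s * (ua (z + s * b + x * a) - ua (z + x * a))"
    by auto
  have "\<exists>y>0. y < s \<and> ua (z + x * a + s * b) - ua (z + x * a + of_real 0 * b)
      = (s - 0) * uab (z + x * a + y * b)"
  proof (rule MVT2[OF \<open>0 < s\<close>])
    fix y assume "0 \<le> y" "y \<le> s"
    then have "z + x * a + y * b \<in> ball z r"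
      using in_ball[of x y] x by auto
    then show "((\<lambda>y. ua (z + x * a + of_real y * b)) has_real_derivative
        uab (z + x * a + y * b)) (at y)"
      by (rule uab)
  qed
  then obtain y where y: "0 < y" "y < s"
    and uy: "ua (z + x * a + s * b) - ua (z + x * a) = s * uab (z + x * a + y * b)"
    by auto
  have "u (z + s * a + s * b) - u (z + s * a) - u (z + s * b) + u z = s * s * uab (z + x * a + y * b)"
    using ux uy by (simp add: algebra_simps)
  moreover have "z + x * a + y * b \<in> ball z r"
    using in_ball[of x y] x y by auto
  ultimately show ?thesis
    by blast
qed

lemma has_derivative_along_line:
  fixes f :: "complex \<Rightarrow> real"
  assumes "(f has_derivative (\<lambda>v. p * Re v + q * Im v)) (at (w + of_real x * a))"
  shows "((\<lambda>t. f (w + of_real t * a)) has_real_derivative p * Re a + q * Im a) (at x)"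
proof -
  have "((\<lambda>t. w + of_real t * a) has_derivative (\<lambda>t. of_real t * a)) (at x)"
    by (auto intro!: derivative_eq_intros)
  from has_derivative_compose[OF this assms]
  have "((\<lambda>t. f (w + of_real t * a)) has_derivative (\<lambda>t. p * Re (of_real t * a) + q * Im (of_real t * a))) (at x)" .
  moreover have "(\<lambda>t. p * Re (of_real t * a) + q * Im (of_real t * a)) = (*) (p * Re a + q * Im a)"
    by (simp add: fun_eq_iff algebra_simps)
  ultimately show ?thesis
    by (simp add: has_field_derivative_def)
qed

lemma mixed_partials_eq:
  fixes u ux uy uxx uxy uyx uyy :: "complex \<Rightarrow> real"
  assumes "open S" and "z \<in> S"
    and u: "\<forall>z\<in>S. (u has_derivative (\<lambda>v. ux z * Re v + uy z * Im v)) (at z)"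
    and ux: "\<forall>z\<in>S. (ux has_derivative (\<lambda>v. uxx z * Re v + uxy z * Im v)) (at z)"
    and uy: "\<forall>z\<in>S. (uy has_derivative (\<lambda>v. uyx z * Re v + uyy z * Im v)) (at z)"
    and cont: "continuous_on S uxy" "continuous_on S uyx"
  shows "uxy z = uyx z"
proof (rule ccontr)
  \<comment> \<open>Half of the supposed gap: a value within \<open>e\<close> of
    \<open>uxy z\<close> and a value within \<open>e\<close> of \<open>uyx z\<close> cannot
    coincide.\<close>
  define e where "e = \<bar>uxy z - uyx z\<bar> / 2"
  assume "uxy z \<noteq> uyx z"
  then have "e > 0"
    by (simp add: e_def)
  obtain r0 where r0: "r0 > 0" "ball z r0 \<subseteq> S"
    using openE[OF \<open>open S\<close> \<open>z \<in> S\<close>] by blast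
  obtain r1 where r1: "r1 > 0" "\<And>w. w \<in> S \<Longrightarrow> dist w z < r1 \<Longrightarrow> dist (uxy w) (uxy z) < e"
    using cont(1)[unfolded continuous_on_iff, rule_format, OF \<open>z \<in> S\<close> \<open>e > 0\<close>]
    by (elim exE conjE) (rule that; blast)
  obtain r2 where r2: "r2 > 0" "\<And>w. w \<in> S \<Longrightarrow> dist w z < r2 \<Longrightarrow> dist (uyx w) (uyx z) < e"
    using cont(2)[unfolded continuous_on_iff, rule_format, OF \<open>z \<in> S\<close> \<open>e > 0\<close>]
    by (elim exE conjE) (rule that; blast)
  define r where "r = min r0 (min r1 r2)"
  have "r > 0"
    using r0 r1 r2 by (simp add: r_def)
  have ball: "ball z r \<subseteq> S"
    using r0 by (auto simp: r_def)
  define s where "s = r / 3"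
  have s: "0 < s" "2 * s < r"
    using \<open>r > 0\<close> by (auto simp: s_def)
  let ?D = "u (z + of_real s * 1 + of_real s * \<i>) - u (z + of_real s * 1) - u (z + of_real s * \<i>) + u z"
  have "\<exists>w\<in>ball z r. ?D = s * s * uxy w"
  proof (rule second_difference_mvt[where ua = ux])
    fix w and x :: real
    show "((\<lambda>t. u (w + of_real t * 1)) has_real_derivative ux (w + of_real x * 1)) (at x)"
      if "w + of_real x * 1 \<in> ball z r"
      using has_derivative_along_line[OF u[rule_format, OF subsetD[OF ball that]]] by simp
    show "((\<lambda>t. ux (w + of_real t * \<i>)) has_real_derivative uxy (w + of_real x * \<i>)) (at x)"
      if "w + of_real x * \<i> \<in> ball z r"
      using has_derivative_along_line[OF ux[rule_format, OF subsetD[OF ball that]]] by simp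
  qed (use s in auto)
  then obtain w1 where w1: "w1 \<in> ball z r" "?D = s * s * uxy w1"
    by blast
  \<comment> \<open>The second difference is symmetric in the two directions; exchanging them
    replaces \<open>uxy\<close> by \<open>uyx\<close>.\<close>
  have "\<exists>w\<in>ball z r. u (z + of_real s * \<i> + of_real s * 1) - u (z + of_real s * \<i>) - u (z + of_real s * 1) + u z = s * s * uyx w"
  proof (rule second_difference_mvt[where ua = uy])
    fix w and x :: real
    show "((\<lambda>t. u (w + of_real t * \<i>)) has_real_derivative uy (w + of_real x * \<i>)) (at x)"
      if "w + of_real x * \<i> \<in> ball z r"
      using has_derivative_along_line[OF u[rule_format, OF subsetD[OF ball that]]] by simp
    show "((\<lambda>t. uy (w + of_real t * 1)) has_real_derivative uyx (w + of_real x * 1)) (at x)"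
      if "w + of_real x * 1 \<in> ball z r"
      using has_derivative_along_line[OF uy[rule_format, OF subsetD[OF ball that]]] by simp
  qed (use s in auto)
  then obtain w2 where w2: "w2 \<in> ball z r" "?D = s * s * uyx w2"
    by (auto simp: algebra_simps)
  have "uxy w1 = uyx w2"
    using w1(2) w2(2) s by simp
  moreover have "dist (uxy w1) (uxy z) < e" "dist (uyx w2) (uyx z) < e"
    using r1(2)[OF subsetD[OF ball w1(1)]] r2(2)[OF subsetD[OF ball w2(1)]] w1(1) w2(1)
    by (auto simp: r_def dist_commute)
  ultimately show False
    by (simp add: e_def dist_real_def abs_if split: if_splits)
qed

section \<open>Harmonic functions as real parts, and Harnack's inequality\<close>

lemma open_upper_half_plane: "open upper_half_plane"
  by (simp add: upper_half_plane_def open_halfspace_Im_gt)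

lemma convex_upper_half_plane: "convex upper_half_plane"
  by (simp add: upper_half_plane_def convex_halfspace_Im_gt)

text \<open>The candidate for the derivative is \<open>ux - \<i> * uy\<close>: the vanishing
  Laplacian and the equality of the mixed partials are its Cauchy-Riemann equations. A primitive
  \<open>F\<close> exists by convexity, and \<open>Re F\<close> has the same gradient as
  \<open>u\<close>, so the two differ by a constant.\<close>

lemma harmonic_on_convex_imp_Re_holomorphic:
  assumes "harmonic_on u S" and "convex S"
  obtains \<Phi> where "\<Phi> holomorphic_on S" and "\<And>z. z \<in> S \<Longrightarrow> u z = Re (\<Phi> z)"
proof -
  obtain ux uy uxx uxy uyx uyy where "open S"
    and u: "\<forall>z\<in>S. (u has_derivative (\<lambda>v. ux z * Re v + uy z * Im v)) (at z)"
    and ux: "\<forall>z\<in>S. (ux has_derivative (\<lambda>v. uxx z * Re v + uxy z * Im v)) (at z)"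
    and uy: "\<forall>z\<in>S. (uy has_derivative (\<lambda>v. uyx z * Re v + uyy z * Im v)) (at z)"
    and cont: "continuous_on S uxy" "continuous_on S uyx"
    and lap: "\<forall>z\<in>S. uxx z + uyy z = 0"
    using assms(1)[unfolded harmonic_on_def] by (elim conjE exE) (rule that; assumption)
  have mixed: "uxy z = uyx z" if "z \<in> S" for z
    using mixed_partials_eq[OF \<open>open S\<close> that u ux uy cont] .
  define \<phi> where "\<phi> z = of_real (ux z) - \<i> * of_real (uy z)" for z
  have \<phi>: "(\<phi> has_field_derivative Complex (uxx z) (- uyx z)) (at z)" if "z \<in> S" for z
  proof -
    have "(\<phi> has_derivative (\<lambda>v. of_real (uxx z * Re v + uxy z * Im v) - \<i> * of_real (uyx z * Re v + uyy z * Im v))) (at z)"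
      unfolding \<phi>_def using ux uy that
      by (intro has_derivative_diff has_derivative_mult_right has_derivative_of_real) auto
    moreover have "(\<lambda>v. of_real (uxx z * Re v + uxy z * Im v) - \<i> * of_real (uyx z * Re v + uyy z * Im v))
        = (*) (Complex (uxx z) (- uyx z))"
    proof
      fix v
      have "uyy z = - uxx z"
        using lap that by (simp add: eq_neg_iff_add_eq_0 add.commute)
      then show "of_real (uxx z * Re v + uxy z * Im v) - \<i> * of_real (uyx z * Re v + uyy z * Im v)
          = Complex (uxx z) (- uyx z) * v"
        using mixed[OF that] by (simp add: complex_eq_iff algebra_simps)
    qed
    ultimately show ?thesis
      by (simp add: has_field_derivative_def)
  qed
  then have "\<phi> holomorphic_on S"
    using \<open>open S\<close> by (auto simp: holomorphic_on_open)
  then obtain F where F': "\<And>z. z \<in> S \<Longrightarrow> (F has_field_derivative \<phi> z) (at z within S)"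
    using holomorphic_convex_primitive'[OF assms(2) \<open>open S\<close>] by blast
  have F: "(F has_field_derivative \<phi> z) (at z)" if "z \<in> S" for z
    using F'[OF that] at_within_open[OF that \<open>open S\<close>] by simp
  have "((\<lambda>z. u z - Re (F z)) has_derivative (\<lambda>v. 0)) (at z within S)" if "z \<in> S" for z
  proof -
    have "((\<lambda>z. Re (F z)) has_derivative (\<lambda>v. Re (\<phi> z * v))) (at z)"
      using F[OF that] by (intro has_derivative_Re) (simp add: has_field_derivative_def)
    with u that have "((\<lambda>z. u z - Re (F z)) has_derivative
        (\<lambda>v. (ux z * Re v + uy z * Im v) - Re (\<phi> z * v))) (at z)"
      by (intro has_derivative_diff) auto
    then show ?thesis
      by (simp add: \<phi>_def algebra_simps has_derivative_at_withinI)
  qed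
  then obtain c where c: "\<And>z. z \<in> S \<Longrightarrow> u z - Re (F z) = c"
    using has_derivative_zero_constant[OF assms(2), of "\<lambda>z. u z - Re (F z)"] by blast
  show ?thesis
  proof
    show "(\<lambda>z. F z + of_real c) holomorphic_on S"
      using F \<open>open S\<close> by (intro holomorphic_intros) (auto simp: holomorphic_on_open)
    show "u z = Re (F z + of_real c)" if "z \<in> S" for z
      using c[OF that] by simp
  qed
qed

text \<open>The Schwarz lemma applied to \<open>q\<close>, the composition of \<open>W\<close> with
  the Moebius map that sends the right half-plane to the disc and \<open>W 0\<close> to 0.\<close>

lemma harnack_disc:
  assumes "W holomorphic_on ball 0 1" and pos: "\<And>z. cmod z < 1 \<Longrightarrow> 0 < Re (W z)" and "cmod z < 1"
  shows "Re (W z) * (1 - cmod z) \<le> Re (W 0) * (1 + cmod z)"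
proof -
  define a where "a = W 0"
  have sq: "(cmod (w + cnj a))\<^sup>2 = (cmod (w - a))\<^sup>2 + 4 * Re w * Re a" for w
    by (simp add: cmod_power2) (simp add: power2_eq_square algebra_simps)
  have "0 < Re a"
    using pos[of 0] by (simp add: a_def)
  have nz: "W z + cnj a \<noteq> 0" if "cmod z < 1" for z
    using pos[OF that] \<open>0 < Re a\<close> by (auto simp: complex_eq_iff)
  define q where "q z = (W z - a) / (W z + cnj a)" for z
  have "q holomorphic_on ball 0 1"
    unfolding q_def using assms(1) nz by (intro holomorphic_intros) auto
  moreover have "q 0 = 0"
    by (simp add: q_def a_def)
  moreover have "cmod (q z) < 1" if "cmod z < 1" for z
  proof -
    have "(cmod (W z - a))\<^sup>2 < (cmod (W z + cnj a))\<^sup>2"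
      using sq[of "W z"] pos[OF that] \<open>0 < Re a\<close> by simp
    then have "cmod (W z - a) < cmod (W z + cnj a)"
      by (rule power_less_imp_less_base) simp
    then show ?thesis
      using nz[OF that] by (simp add: q_def norm_divide)
  qed
  ultimately have "cmod (q z) \<le> cmod z"
    using Schwarz_Lemma(1) \<open>cmod z < 1\<close> by blast
  then have "cmod (W z - a) \<le> cmod z * cmod (W z + cnj a)"
    using nz[OF \<open>cmod z < 1\<close>] by (simp add: q_def norm_divide divide_simps mult.commute)
  then have "(cmod (W z - a))\<^sup>2 \<le> (cmod z)\<^sup>2 * (cmod (W z + cnj a))\<^sup>2"
    by (metis norm_ge_zero power_mono power_mult_distrib)
  then have "(1 - (cmod z)\<^sup>2) * (cmod (W z - a))\<^sup>2 \<le> (cmod z)\<^sup>2 * (4 * Re (W z) * Re a)"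
    unfolding sq by (simp add: algebra_simps)
  \<comment> \<open>Only the real part of \<open>W z - a\<close> is kept; the estimate then involves
    \<open>Re (W z)\<close> alone and becomes a comparison of two squares.\<close>
  moreover have "(1 - (cmod z)\<^sup>2) * (Re (W z) - Re a)\<^sup>2 \<le> (1 - (cmod z)\<^sup>2) * (cmod (W z - a))\<^sup>2"
  proof (rule mult_left_mono)
    show "(Re (W z) - Re a)\<^sup>2 \<le> (cmod (W z - a))\<^sup>2"
      by (simp add: cmod_power2)
    show "0 \<le> 1 - (cmod z)\<^sup>2"
      using \<open>cmod z < 1\<close> by (simp add: power_le_one)
  qed
  ultimately have "(1 - (cmod z)\<^sup>2) * (Re (W z) - Re a)\<^sup>2 \<le> (cmod z)\<^sup>2 * (4 * Re (W z) * Re a)"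
    by (rule order_trans[rotated])
  moreover have "(cmod z * (Re (W z) + Re a))\<^sup>2
      = (cmod z)\<^sup>2 * (Re (W z) - Re a)\<^sup>2 + (cmod z)\<^sup>2 * (4 * Re (W z) * Re a)"
    by (simp add: power2_eq_square algebra_simps)
  ultimately have "(Re (W z) - Re a)\<^sup>2 \<le> (cmod z * (Re (W z) + Re a))\<^sup>2"
    by (simp add: left_diff_distrib)
  moreover have "0 \<le> cmod z * (Re (W z) + Re a)"
    using pos[OF \<open>cmod z < 1\<close>] \<open>0 < Re a\<close> by simp
  ultimately have "Re (W z) - Re a \<le> cmod z * (Re (W z) + Re a)"
    by (rule power2_le_imp_le)
  then show ?thesis
    by (simp add: a_def algebra_simps)
qed

lemma cmod_diff_cnj_square:
  "(cmod (z - cnj w))\<^sup>2 = (cmod (z - w))\<^sup>2 + 4 * Im z * Im w"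
  by (simp add: cmod_power2) (simp add: power2_eq_square algebra_simps)

text \<open>\<open>harnack_disc\<close> transported by a Cayley map with \<open>C 0 = z0\<close>.
  The ratio \<open>(D + d) / (D - d)\<close> that it yields equals
  \<open>(D + d)\<^sup>2 / (D\<^sup>2 - d\<^sup>2)\<close>; the denominator is
  \<open>4 * Im z * Im z0\<close> and the numerator at most \<open>4 * D\<^sup>2\<close>.\<close>

lemma harnack_half_plane:
  assumes "\<Phi> holomorphic_on upper_half_plane"
    and nonneg: "\<And>z. z \<in> upper_half_plane \<Longrightarrow> 0 \<le> Re (\<Phi> z)"
    and "z \<in> upper_half_plane" and "z0 \<in> upper_half_plane"
  shows "Re (\<Phi> z) \<le> Re (\<Phi> z0) * (cmod (z - cnj z0))\<^sup>2 / (Im z * Im z0)"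
proof -
  have im: "0 < Im z" "0 < Im z0"
    using assms by (auto simp: upper_half_plane_def)
  define D d where "D = cmod (z - cnj z0)" and "d = cmod (z - z0)"
  have Dd: "D\<^sup>2 = d\<^sup>2 + 4 * Im z * Im z0" "0 \<le> d" "0 \<le> D"
    by (simp_all add: D_def d_def cmod_diff_cnj_square)
  have "d < D"
    using Dd im by (intro power_less_imp_less_base[of d 2 D]) auto
  define C where "C \<zeta> = of_real (Re z0) + \<i> * of_real (Im z0) * ((1 + \<zeta>) / (1 - \<zeta>))" for \<zeta> :: complex
  have C_in: "C \<zeta> \<in> upper_half_plane" if "cmod \<zeta> < 1" for \<zeta>
  proof -
    have "Re \<zeta> < 1"
      using that complex_Re_le_cmod[of \<zeta>] by simp
    have "(cmod \<zeta>)\<^sup>2 < 1"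
      using that by (simp add: abs_square_less_1)
    have "Re (1 + \<zeta>) * Re (1 - \<zeta>) + Im (1 + \<zeta>) * Im (1 - \<zeta>) = 1 - (cmod \<zeta>)\<^sup>2"
      by (simp add: cmod_power2) (simp add: power2_eq_square algebra_simps)
    moreover have "0 < (Re (1 - \<zeta>))\<^sup>2 + (Im (1 - \<zeta>))\<^sup>2"
      using \<open>Re \<zeta> < 1\<close> by (intro add_pos_nonneg) auto
    ultimately have "0 < Re ((1 + \<zeta>) / (1 - \<zeta>))"
      using \<open>(cmod \<zeta>)\<^sup>2 < 1\<close> unfolding Re_divide by simp
    then show ?thesis
      using im by (simp add: upper_half_plane_def C_def del: times_divide_eq_right)
  qed
  have C_hol: "C holomorphic_on ball 0 1"
    unfolding C_def by (intro holomorphic_intros) auto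
  \<comment> \<open>The preimage of \<open>z\<close> under \<open>C\<close>; its modulus
    \<open>d / D\<close> is the pseudo-hyperbolic distance of \<open>z\<close> and
    \<open>z0\<close>.\<close>
  define \<zeta> where "\<zeta> = (z - z0) / (z - cnj z0)"
  have "z - cnj z0 \<noteq> 0"
    using im by (auto simp: complex_eq_iff)
  have \<zeta>_norm: "cmod \<zeta> = d / D"
    by (simp add: \<zeta>_def norm_divide D_def d_def)
  then have "cmod \<zeta> < 1"
    using \<open>d < D\<close> Dd by simp
  have "C 0 = z0"
    by (simp add: C_def complex_eq_iff)
  have "\<zeta> * (z - cnj z0) = z - z0"
    using \<open>z - cnj z0 \<noteq> 0\<close> by (simp add: \<zeta>_def)
  then have "z * (1 - \<zeta>) = z0 - \<zeta> * cnj z0"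
    by (simp add: algebra_simps)
  also have "\<dots> = of_real (Re z0) * (1 - \<zeta>) + \<i> * of_real (Im z0) * (1 + \<zeta>)"
    by (simp add: complex_eq_iff algebra_simps)
  finally have "z * (1 - \<zeta>) = of_real (Re z0) * (1 - \<zeta>) + \<i> * of_real (Im z0) * (1 + \<zeta>)" .
  moreover have "1 - \<zeta> \<noteq> 0"
    using \<open>cmod \<zeta> < 1\<close> by auto
  ultimately have "C \<zeta> = z"
    unfolding C_def by (simp add: field_simps)
  \<comment> \<open>\<open>harnack_disc\<close> asks for a strictly positive real part, so
    \<open>e\<close> is added and sent to 0 afterwards.\<close>
  have shifted: "(Re (\<Phi> z) + e) * (1 - d / D) \<le> (Re (\<Phi> z0) + e) * (1 + d / D)" if "e > 0" for e
  proof -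
    have "Re (\<Phi> (C \<zeta>) + of_real e) * (1 - cmod \<zeta>) \<le> Re (\<Phi> (C 0) + of_real e) * (1 + cmod \<zeta>)"
    proof (rule harnack_disc)
      have "(\<Phi> \<circ> C) holomorphic_on ball 0 1"
        using C_hol C_in by (intro holomorphic_on_compose_gen[OF _ assms(1)]) auto
      then show "(\<lambda>\<zeta>. \<Phi> (C \<zeta>) + of_real e) holomorphic_on ball 0 1"
        by (auto simp: o_def intro!: holomorphic_intros)
      show "0 < Re (\<Phi> (C w) + of_real e)" if "cmod w < 1" for w
        using nonneg[OF C_in[OF that]] \<open>e > 0\<close> by simp
    qed fact
    then show ?thesis
      by (simp add: \<open>C \<zeta> = z\<close> \<open>C 0 = z0\<close> \<zeta>_norm)
  qed
  have "Re (\<Phi> z) * (1 - d / D) \<le> Re (\<Phi> z0) * (1 + d / D)"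
  proof (rule tendsto_le)
    show "((\<lambda>e. (Re (\<Phi> z) + e) * (1 - d / D)) \<longlongrightarrow> Re (\<Phi> z) * (1 - d / D)) (at_right 0)"
      by (rule tendsto_eq_intros refl | simp)+
    show "((\<lambda>e. (Re (\<Phi> z0) + e) * (1 + d / D)) \<longlongrightarrow> Re (\<Phi> z0) * (1 + d / D)) (at_right 0)"
      by (rule tendsto_eq_intros refl | simp)+
    show "\<forall>\<^sub>F e in at_right 0. (Re (\<Phi> z) + e) * (1 - d / D) \<le> (Re (\<Phi> z0) + e) * (1 + d / D)"
      using shifted by (auto simp: eventually_at_filter)
  qed simp
  then have "Re (\<Phi> z) * (1 - d / D) * D \<le> Re (\<Phi> z0) * (1 + d / D) * D"
    using Dd by (intro mult_right_mono) auto
  moreover have "(1 - d / D) * D = D - d" "(1 + d / D) * D = D + d"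
    using \<open>d < D\<close> Dd by (simp_all add: field_simps)
  ultimately have "Re (\<Phi> z) * (D - d) \<le> Re (\<Phi> z0) * (D + d)"
    by (simp add: mult.assoc)
  then have "Re (\<Phi> z) * (D - d) * (D + d) \<le> Re (\<Phi> z0) * (D + d) * (D + d)"
    using Dd by (intro mult_right_mono) auto
  also have "\<dots> = Re (\<Phi> z0) * (D + d)\<^sup>2"
    by (simp add: power2_eq_square)
  also have "\<dots> \<le> Re (\<Phi> z0) * (2 * D)\<^sup>2"
    using Dd \<open>d < D\<close> nonneg[OF assms(4)] by (intro mult_left_mono power_mono) auto
  finally have "Re (\<Phi> z) * (D\<^sup>2 - d\<^sup>2) \<le> Re (\<Phi> z0) * (4 * D\<^sup>2)"
    by (simp add: power2_eq_square algebra_simps)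
  moreover have "D\<^sup>2 - d\<^sup>2 = 4 * (Im z * Im z0)"
    using Dd(1) by simp
  ultimately have "Re (\<Phi> z) * (Im z * Im z0) \<le> Re (\<Phi> z0) * D\<^sup>2"
    by simp
  moreover have "0 < Im z * Im z0"
    using im by simp
  ultimately show ?thesis
    unfolding D_def by (simp only: pos_le_divide_eq)
qed

text \<open>Subtracting \<open>c * Im z\<close> leaves a nonnegative harmonic function, since
  \<open>c\<close> is the infimum of \<open>u z / Im z\<close>. Harnack's inequality is started from
  a point \<open>z0\<close> where this remainder is at most \<open>e / 4 * Im z0\<close>; the factor
  1/4 pays for \<open>cmod (z - cnj z0) \<le> 2 * cmod z\<close>, which enters squared.\<close>

lemma nonneg_harmonic_growth:
  assumes "harmonic_on u upper_half_plane"
    and nonneg: "\<And>z. z \<in> upper_half_plane \<Longrightarrow> 0 \<le> u z"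
  obtains c where "0 \<le> c" and "\<And>e. e > 0 \<Longrightarrow> \<exists>R>0. \<forall>z\<in>upper_half_plane. R \<le> cmod z \<longrightarrow>
      u z \<le> c * Im z + e * (cmod z)\<^sup>2 / Im z"
proof -
  obtain \<Phi> where \<Phi>: "\<Phi> holomorphic_on upper_half_plane" "\<And>z. z \<in> upper_half_plane \<Longrightarrow> u z = Re (\<Phi> z)"
    using harmonic_on_convex_imp_Re_holomorphic[OF assms(1) convex_upper_half_plane] by blast
  define c where "c = (INF z\<in>upper_half_plane. u z / Im z)"
  have bdd: "bdd_below ((\<lambda>z. u z / Im z) ` upper_half_plane)"
    using nonneg by (intro bdd_belowI2[where m = 0]) (auto simp: upper_half_plane_def)
  have "\<i> \<in> upper_half_plane"
    by (simp add: upper_half_plane_def)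
  then have ne: "upper_half_plane \<noteq> {}"
    by blast
  have c_le: "c * Im z \<le> u z" if "z \<in> upper_half_plane" for z
    using cINF_lower[OF bdd that] that by (simp add: c_def upper_half_plane_def field_simps)
  show ?thesis
  proof
    show "0 \<le> c"
      unfolding c_def using nonneg by (intro cINF_greatest ne) (auto simp: upper_half_plane_def)
    fix e :: real
    assume "e > 0"
    then have "c < c + e / 4"
      by simp
    then obtain z0 where z0: "z0 \<in> upper_half_plane" "u z0 / Im z0 < c + e / 4"
      unfolding c_def using cINF_less_iff[OF ne bdd] by blast
    then have im0: "Im z0 > 0"
      by (simp add: upper_half_plane_def)
    have "u z \<le> c * Im z + e * (cmod z)\<^sup>2 / Im z"
      if z: "z \<in> upper_half_plane" "cmod z0 \<le> cmod z" for z
    proof -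
      have im: "Im z > 0"
        using z by (simp add: upper_half_plane_def)
      \<comment> \<open>\<open>\<i> * of_real c * z\<close> has real part \<open>- c * Im z\<close>,
        so this is Harnack's inequality for the remainder.\<close>
      have "Re (\<Phi> z + \<i> * of_real c * z) \<le> Re (\<Phi> z0 + \<i> * of_real c * z0) * (cmod (z - cnj z0))\<^sup>2 / (Im z * Im z0)"
      proof (rule harnack_half_plane)
        show "(\<lambda>z. \<Phi> z + \<i> * of_real c * z) holomorphic_on upper_half_plane"
          using \<Phi>(1) by (intro holomorphic_intros)
        show "0 \<le> Re (\<Phi> z + \<i> * of_real c * z)" if "z \<in> upper_half_plane" for z
          using c_le[OF that] \<Phi>(2)[OF that] by simp
      qed fact+
      then have "u z - c * Im z \<le> (u z0 - c * Im z0) * (cmod (z - cnj z0))\<^sup>2 / (Im z * Im z0)"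
        using \<Phi>(2) z z0 by simp
      also have "\<dots> \<le> (e / 4 * Im z0) * (2 * cmod z)\<^sup>2 / (Im z * Im z0)"
      proof (intro divide_right_mono mult_mono power_mono)
        show "u z0 - c * Im z0 \<le> e / 4 * Im z0"
          using z0(2) im0 by (simp add: field_simps)
        show "cmod (z - cnj z0) \<le> 2 * cmod z"
          using norm_triangle_ineq4[of z "cnj z0"] z by simp
      qed (use im im0 \<open>e > 0\<close> in auto)
      also have "\<dots> = e * (cmod z)\<^sup>2 / Im z"
        using im0 by (simp add: power_mult_distrib)
      finally show ?thesis
        by simp
    qed
    moreover have "cmod z0 > 0"
      using im0 by auto
    ultimately show "\<exists>R>0. \<forall>z\<in>upper_half_plane. R \<le> cmod z \<longrightarrow> u z \<le> c * Im z + e * (cmod z)\<^sup>2 / Im z"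
      by blast
  qed
qed

section \<open>Phragmen-Lindelof principles\<close>

text \<open>The multipliers have modulus at most 1, which preserves the bound on the frontier, and
  they beat the growth of \<open>F\<close> at infinity, so the maximum principle applies on
  \<open>S\<close> cut off by a large disc. Letting \<open>e\<close> tend to 0 removes them
  again.\<close>

lemma phragmen_lindelof_multiplier:
  fixes F :: "complex \<Rightarrow> complex" and \<psi> :: "real \<Rightarrow> complex \<Rightarrow> complex"
  assumes "open S" and "F holomorphic_on S" and "continuous_on (closure S) F" and "0 \<le> M"
    and F_le: "\<And>z. z \<in> frontier S \<Longrightarrow> cmod (F z) \<le> M"
    and \<psi>_hol: "\<And>e. e > 0 \<Longrightarrow> \<psi> e holomorphic_on S"
    and \<psi>_cont: "\<And>e. e > 0 \<Longrightarrow> continuous_on (closure S) (\<psi> e)"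
    and \<psi>_le: "\<And>e z. e > 0 \<Longrightarrow> z \<in> closure S \<Longrightarrow> cmod (\<psi> e z) \<le> 1"
    and small: "\<And>e d. e > 0 \<Longrightarrow> d > 0 \<Longrightarrow>
      \<exists>R. \<forall>z\<in>closure S. R \<le> cmod z \<longrightarrow> cmod (F z * \<psi> e z) \<le> d"
    and lim: "\<And>z. z \<in> S \<Longrightarrow> ((\<lambda>e. \<psi> e z) \<longlongrightarrow> 1) (at_right 0)"
    and "z \<in> S"
  shows "cmod (F z) \<le> M"
proof -
  have bound: "cmod (F z * \<psi> e z) \<le> M" if "e > 0" for e
  proof (rule field_le_epsilon)
    fix d :: real
    assume "d > 0"
    then obtain R where R: "\<And>z. z \<in> closure S \<Longrightarrow> R \<le> cmod z \<Longrightarrow> cmod (F z * \<psi> e z) \<le> d"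
      using small[OF \<open>e > 0\<close>] by blast
    \<comment> \<open>Beyond \<open>R\<close> the product is at most \<open>d\<close>, which
      controls the circular part of the frontier; \<open>cmod z + 1\<close> keeps \<open>z\<close>
      inside the truncated domain.\<close>
    define R' where "R' = max R (cmod z + 1)"
    let ?T = "S \<inter> ball 0 R'"
    have "R' > 0"
      by (auto simp: R'_def less_max_iff_disj add_nonneg_pos)
    have closT: "closure ?T \<subseteq> closure S"
      by (rule closure_mono) auto
    show "cmod (F z * \<psi> e z) \<le> M + d"
    proof (rule maximum_modulus_frontier[where S = ?T and \<xi> = z and f = "\<lambda>z. F z * \<psi> e z"])
      show "(\<lambda>z. F z * \<psi> e z) holomorphic_on interior ?T"
        using assms(2) \<psi>_hol[OF that] interior_subset[of ?T]
        by (intro holomorphic_intros) (auto intro: holomorphic_on_subset)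
      show "continuous_on (closure ?T) (\<lambda>z. F z * \<psi> e z)"
        using assms(3) \<psi>_cont[OF that] closT
        by (intro continuous_intros) (auto intro: continuous_on_subset)
      show "bounded ?T"
        by (simp add: bounded_Int)
      show "z \<in> ?T"
        using \<open>z \<in> S\<close> by (simp add: R'_def)
      fix w
      assume w: "w \<in> frontier ?T"
      then have w_clos: "w \<in> closure S"
        using closT by (auto simp: frontier_def)
      have "w \<in> frontier S \<or> w \<in> frontier (ball 0 R')"
        using w frontier_Int_subset[of S "ball 0 R'"] by blast
      then show "cmod (F w * \<psi> e w) \<le> M + d"
      proof
        assume "w \<in> frontier S"
        then have "cmod (F w) * cmod (\<psi> e w) \<le> M * 1"
          using F_le \<psi>_le[OF that w_clos] \<open>0 \<le> M\<close> by (intro mult_mono) auto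
        then show ?thesis
          using \<open>d > 0\<close> by (simp add: norm_mult)
      next
        assume "w \<in> frontier (ball 0 R')"
        then have "R \<le> cmod w"
          using \<open>R' > 0\<close> by (simp add: R'_def)
        then show ?thesis
          using R[OF w_clos] \<open>0 \<le> M\<close> by simp
      qed
    qed
  qed
  have "((\<lambda>e. cmod (F z * \<psi> e z)) \<longlongrightarrow> cmod (F z * 1)) (at_right 0)"
    using lim[OF \<open>z \<in> S\<close>] by (intro tendsto_intros)
  then have "cmod (F z * 1) \<le> M"
    by (rule tendsto_upperbound) (auto simp: eventually_at_filter bound)
  then show ?thesis
    by simp
qed

text \<open>If \<open>s\<^sup>2\<close> has argument at most pi/4 in modulus, then \<open>s\<close>
  has at most pi/8 and \<open>s ^ 3\<close> at most 3 pi/8, which is below pi/2. The intended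
  \<open>s\<close> is \<open>csqrt w\<close>, for which this bounds from below the real part of the
  power 3/2 of \<open>w\<close>.\<close>

lemma Re_cube_ge:
  assumes "0 \<le> Re s" and "\<bar>Im (s\<^sup>2)\<bar> \<le> Re (s\<^sup>2)"
  shows "2 / 5 * Re (s\<^sup>2) * sqrt (Re (s\<^sup>2)) \<le> Re (s ^ 3)"
proof -
  define p q where "p = Re s" and "q = Im s"
  have s: "s = Complex p q"
    by (simp add: p_def q_def)
  have sq: "Re (s\<^sup>2) = p\<^sup>2 - q\<^sup>2" "Im (s\<^sup>2) = 2 * p * q"
    by (simp_all add: s power2_eq_square)
  have cube: "Re (s ^ 3) = p * (p\<^sup>2 - 3 * q\<^sup>2)"
    by (simp add: s power3_eq_cube power2_eq_square algebra_simps)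
  have "q\<^sup>2 \<le> p\<^sup>2"
    using assms(2) unfolding sq by linarith
  have "(2 * p * q)\<^sup>2 \<le> (p\<^sup>2 - q\<^sup>2)\<^sup>2"
    using assms(2) unfolding sq by (metis abs_ge_zero power2_abs power_mono)
  then have quart: "0 \<le> p\<^sup>2 * p\<^sup>2 - 6 * (p\<^sup>2 * q\<^sup>2) + q\<^sup>2 * q\<^sup>2"
    by (simp add: power2_eq_square algebra_simps)
  \<comment> \<open>The square of tan (pi/8) is 3 - 2 sqrt 2, which is below 1/5. Hence
    \<open>p\<^sup>2 - 3 * q\<^sup>2\<close> is at least \<open>2 / 5 * p\<^sup>2\<close>, the
    source of the constant 2/5.\<close>
  have "5 * q\<^sup>2 \<le> p\<^sup>2"
  proof (rule ccontr)
    assume *: "\<not> 5 * q\<^sup>2 \<le> p\<^sup>2"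
    then have "0 \<le> (5 * q\<^sup>2 - p\<^sup>2) * (p\<^sup>2 - q\<^sup>2)"
      using \<open>q\<^sup>2 \<le> p\<^sup>2\<close> by (intro mult_nonneg_nonneg) auto
    moreover have "(5 * q\<^sup>2 - p\<^sup>2) * (p\<^sup>2 - q\<^sup>2)
        = 6 * (p\<^sup>2 * q\<^sup>2) - p\<^sup>2 * p\<^sup>2 - 5 * (q\<^sup>2 * q\<^sup>2)"
      by (simp add: algebra_simps)
    ultimately have "q\<^sup>2 * q\<^sup>2 \<le> 0"
      using quart by linarith
    then have "q = 0"
      by (simp add: mult_le_0_iff)
    with * show False
      by simp
  qed
  have "0 \<le> p"
    using assms by (simp add: p_def)
  have "sqrt (p\<^sup>2 - q\<^sup>2) \<le> p"
    using \<open>0 \<le> p\<close> by (intro real_le_lsqrt) auto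
  then have "2 / 5 * (p\<^sup>2 - q\<^sup>2) * sqrt (p\<^sup>2 - q\<^sup>2) \<le> 2 / 5 * p\<^sup>2 * p"
    using \<open>q\<^sup>2 \<le> p\<^sup>2\<close> by (intro mult_mono) auto
  also have "\<dots> \<le> (p\<^sup>2 - 3 * q\<^sup>2) * p"
    using \<open>5 * q\<^sup>2 \<le> p\<^sup>2\<close> \<open>0 \<le> p\<close> by (intro mult_right_mono) auto
  finally show ?thesis
    by (simp add: sq cube mult.commute)
qed

text \<open>The multiplier is the exponential of \<open>- e\<close> times a power 3/2. The exponent
  3/2 exceeds 1, the order of the permitted growth, and stays below 2, at which the multiplier would
  cease to decay along the edges of the quadrant.\<close>

lemma phragmen_lindelof_quadrant:
  fixes F :: "complex \<Rightarrow> complex"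
  defines "S \<equiv> {z. 0 < Re z \<and> 0 < Im z}" and "T \<equiv> {z. 0 \<le> Re z \<and> 0 \<le> Im z}"
  assumes "F holomorphic_on S" and "continuous_on T F" and "0 \<le> M"
    and F_le: "\<And>z. z \<in> T \<Longrightarrow> Re z = 0 \<or> Im z = 0 \<Longrightarrow> cmod (F z) \<le> M"
    and growth: "\<And>z. z \<in> T \<Longrightarrow> cmod (F z) \<le> C * exp (C * cmod z)"
    and "z \<in> T"
  shows "cmod (F z) \<le> M"
proof (cases "z \<in> S")
  case False
  then show ?thesis
    using F_le \<open>z \<in> T\<close> by (auto simp: S_def T_def)
next
  case True
  have S_eq: "S = {z. 0 < Re z} \<inter> {z. 0 < Im z}" and T_eq: "T = {z. 0 \<le> Re z} \<inter> {z. 0 \<le> Im z}"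
    by (auto simp: S_def T_def)
  have "open S"
    unfolding S_eq by (intro open_Int open_halfspace_Re_gt open_halfspace_Im_gt)
  have "closed T"
    unfolding T_eq by (intro closed_Int closed_halfspace_Re_ge closed_halfspace_Im_ge)
  then have clos: "closure S \<subseteq> T"
    by (intro closure_minimal) (auto simp: S_def T_def)
  \<comment> \<open>Multiplication by \<open>1 - \<i>\<close> turns the quadrant into the sector of
    half-angle pi/4 about the positive real axis; the shift by \<open>1 + \<i>\<close> gives
    \<open>Re (w z) \<ge> 2\<close>, away from the branch point of \<open>csqrt\<close>.\<close>
  define w where "w z = (z + 1 + \<i>) * (1 - \<i>)" for z
  have w: "Re (w z) = Re z + Im z + 2" "Im (w z) = Im z - Re z" for z
    by (simp_all add: w_def)
  have w_hol: "w holomorphic_on A" for A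
    unfolding w_def by (intro holomorphic_intros)
  have w_nonpos: "w z \<notin> \<real>\<^sub>\<le>\<^sub>0" if "z \<in> T" for z
    using that by (auto simp: complex_nonpos_Reals_iff w T_def)
  define \<psi> where "\<psi> e z = exp (- of_real e * (csqrt (w z)) ^ 3)" for e :: real and z
  have \<psi>_hol: "\<psi> e holomorphic_on T" for e
    unfolding \<psi>_def using w_nonpos by (intro holomorphic_intros w_hol) auto
  have cube: "2 / 5 * cmod z * sqrt (cmod z) \<le> Re ((csqrt (w z)) ^ 3)" if "z \<in> T" for z
  proof -
    have "cmod z \<le> Re (w z)"
      using cmod_le[of z] that by (simp add: w T_def)
    then have "2 / 5 * cmod z * sqrt (cmod z) \<le> 2 / 5 * Re (w z) * sqrt (Re (w z))"
      by (intro mult_mono) (auto intro: order_trans[OF norm_ge_zero])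
    also have "\<dots> \<le> Re ((csqrt (w z)) ^ 3)"
      using Re_cube_ge[of "csqrt (w z)"] csqrt_principal[of "w z"] that by (auto simp: w T_def)
    finally show ?thesis .
  qed
  have \<psi>_norm: "cmod (\<psi> e z) \<le> exp (- (e * (2 / 5 * cmod z * sqrt (cmod z))))" if "e > 0" "z \<in> T" for e z
    using cube[OF that(2)] that(1) by (simp add: \<psi>_def)
  show ?thesis
  proof (rule phragmen_lindelof_multiplier[OF \<open>open S\<close> assms(3) _ \<open>0 \<le> M\<close>])
    show "continuous_on (closure S) F"
      using assms(4) clos by (rule continuous_on_subset)
    show "cmod (F z) \<le> M" if "z \<in> frontier S" for z
    proof -
      have "z \<in> T" "z \<notin> S"
        using that clos \<open>open S\<close> by (auto simp: frontier_def interior_open)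
      then show ?thesis
        using F_le by (auto simp: S_def T_def)
    qed
    show "\<psi> e holomorphic_on S" for e
      using \<psi>_hol by (rule holomorphic_on_subset) (auto simp: S_def T_def)
    show "continuous_on (closure S) (\<psi> e)" for e
      using holomorphic_on_imp_continuous_on[OF \<psi>_hol] clos by (rule continuous_on_subset)
    show "cmod (\<psi> e z) \<le> 1" if "e > 0" "z \<in> closure S" for e z
      using order_trans[OF \<psi>_norm[of e z]] that clos by (auto simp: subset_iff)
    show "((\<lambda>e. \<psi> e z) \<longlongrightarrow> 1) (at_right 0)" for z
      unfolding \<psi>_def by (auto intro!: tendsto_eq_intros)
    show "\<exists>R. \<forall>z\<in>closure S. R \<le> cmod z \<longrightarrow> cmod (F z * \<psi> e z) \<le> d"
      if "e > 0" "d > 0" for e d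
    proof (intro exI ballI impI)
      fix z
      define r where "r = cmod z"
      \<comment> \<open>From \<open>L \<le> sqrt r\<close> the damping exponent is at least
        \<open>(\<bar>C\<bar> + 1) * r\<close>. The surplus \<open>r\<close> leaves
        \<open>exp (- r) \<le> 1 / r\<close>, and \<open>\<bar>C\<bar> / d \<le> r\<close> finishes;
        the \<open>+ 1\<close> in the radius gives \<open>0 < r\<close>.\<close>
      define L where "L = (\<bar>C\<bar> + 1) / (e * (2 / 5))"
      assume z: "z \<in> closure S" and "max (L\<^sup>2) (\<bar>C\<bar> / d + 1) \<le> cmod z"
      moreover have "0 \<le> \<bar>C\<bar> / d"
        using \<open>d > 0\<close> by simp
      ultimately have r: "L\<^sup>2 \<le> r" "\<bar>C\<bar> / d \<le> r" "0 < r"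
        by (auto simp: r_def simp del: zero_le_divide_iff)
      have "z \<in> T"
        using z clos by blast
      have "L \<le> sqrt r"
        using r(1) real_le_rsqrt by blast
      then have "(\<bar>C\<bar> + 1) \<le> e * (2 / 5) * sqrt r"
        using \<open>e > 0\<close> by (simp add: L_def field_simps)
      then have "(\<bar>C\<bar> + 1) * r \<le> e * (2 / 5) * sqrt r * r"
        using r by (intro mult_right_mono) auto
      then have exponent: "\<bar>C\<bar> * r - e * (2 / 5 * r * sqrt r) \<le> - r"
        by (simp add: algebra_simps)
      have "C * r \<le> \<bar>C\<bar> * r"
        using r by (intro mult_right_mono) auto
      then have "cmod (F z) \<le> \<bar>C\<bar> * exp (\<bar>C\<bar> * r)"
        using growth[OF \<open>z \<in> T\<close>] by (rule_tac order_trans[OF _ mult_mono]) (auto simp: r_def)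
      then have "cmod (F z * \<psi> e z) \<le> (\<bar>C\<bar> * exp (\<bar>C\<bar> * r)) * exp (- (e * (2 / 5 * r * sqrt r)))"
        using \<psi>_norm[OF \<open>e > 0\<close> \<open>z \<in> T\<close>] unfolding norm_mult r_def by (intro mult_mono) auto
      also have "\<dots> = \<bar>C\<bar> * exp (\<bar>C\<bar> * r - e * (2 / 5 * r * sqrt r))"
        by (simp add: mult.assoc mult_exp_exp)
      also have "\<dots> \<le> \<bar>C\<bar> * exp (- r)"
        using exponent by (intro mult_left_mono) auto
      also have "\<dots> \<le> \<bar>C\<bar> * (1 / r)"
      proof (intro mult_left_mono)
        have "r \<le> exp r"
          using exp_ge_add_one_self[of r] by linarith
        then show "exp (- r) \<le> 1 / r"
          using r by (simp add: exp_minus field_simps)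
      qed simp
      also have "\<dots> \<le> d"
        using r \<open>d > 0\<close> by (simp add: field_simps)
      finally show "cmod (F z * \<psi> e z) \<le> d" .
    qed
  qed (use True in auto)
qed

text \<open>As \<open>F\<close> is already bounded, the slowly decaying multiplier
  \<open>1 / (1 + e * z)\<close> is enough to improve the bound to the one on the imaginary
  axis.\<close>

lemma phragmen_lindelof_half_plane:
  fixes F :: "complex \<Rightarrow> complex"
  assumes "F holomorphic_on {z. 0 < Re z}" and "continuous_on {z. 0 \<le> Re z} F" and "0 \<le> M"
    and F_le: "\<And>z. Re z = 0 \<Longrightarrow> cmod (F z) \<le> M"
    and bound: "\<And>z. 0 \<le> Re z \<Longrightarrow> cmod (F z) \<le> B"
    and "0 \<le> Re z"
  shows "cmod (F z) \<le> M"
proof (cases "Re z = 0")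
  case False
  have clos: "closure {z. 0 < Re z} \<subseteq> {z. 0 \<le> Re z}"
    by (intro closure_minimal closed_halfspace_Re_ge) auto
  have "0 \<le> B"
    using order_trans[OF norm_ge_zero bound[of 0]] by simp
  have ge1: "1 \<le> cmod (1 + of_real e * z)" and ge: "e * cmod z \<le> cmod (1 + of_real e * z)"
    if "e > 0" "0 \<le> Re z" for e z
  proof -
    show "1 \<le> cmod (1 + of_real e * z)"
    proof (rule order_trans)
      show "1 \<le> Re (1 + of_real e * z)"
        using that by simp
    qed (rule complex_Re_le_cmod)
    have "(cmod (of_real e * z))\<^sup>2 \<le> (cmod (1 + of_real e * z))\<^sup>2"
      using power_mono[of "e * Re z" "1 + e * Re z" 2] that by (simp add: cmod_power2)
    then have "cmod (of_real e * z) \<le> cmod (1 + of_real e * z)"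
      by (rule power2_le_imp_le) simp
    then show "e * cmod z \<le> cmod (1 + of_real e * z)"
      using that by (simp add: norm_mult)
  qed
  have nz: "1 + of_real e * z \<noteq> 0" if "e > 0" "0 \<le> Re z" for e z
    using ge1[OF that] by auto
  define \<psi> where "\<psi> e z = 1 / (1 + of_real e * z)" for e :: real and z :: complex
  show ?thesis
  proof (rule phragmen_lindelof_multiplier[OF open_halfspace_Re_gt assms(1) _ \<open>0 \<le> M\<close>, of \<psi>])
    show "continuous_on (closure {z. 0 < Re z}) F"
      using assms(2) clos by (rule continuous_on_subset)
    show "cmod (F z) \<le> M" if "z \<in> frontier {z. 0 < Re z}" for z
      using that F_le clos by (auto simp: frontier_def interior_open open_halfspace_Re_gt subset_iff)
    show "\<psi> e holomorphic_on {z. 0 < Re z}" if "e > 0" for e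
      unfolding \<psi>_def using nz[OF that] by (intro holomorphic_intros) auto
    show "continuous_on (closure {z. 0 < Re z}) (\<psi> e)" if "e > 0" for e
      unfolding \<psi>_def using nz[OF that] clos by (intro continuous_intros) auto
    show "cmod (\<psi> e z) \<le> 1" if "e > 0" "z \<in> closure {z. 0 < Re z}" for e z
      using ge1[of e z] that clos by (auto simp: \<psi>_def norm_divide subset_iff divide_le_eq_1)
    show "((\<lambda>e. \<psi> e z) \<longlongrightarrow> 1) (at_right 0)" for z
      unfolding \<psi>_def by (auto intro!: tendsto_eq_intros)
    show "\<exists>R. \<forall>z\<in>closure {z. 0 < Re z}. R \<le> cmod z \<longrightarrow> cmod (F z * \<psi> e z) \<le> d"
      if "e > 0" "d > 0" for e d
    proof (intro exI ballI impI)
      fix z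
      assume z: "z \<in> closure {z. 0 < Re z}" and R: "B / (d * e) \<le> cmod z"
      then have "0 \<le> Re z"
        using clos by blast
      have "B \<le> d * (e * cmod z)"
        using R that by (simp add: field_simps)
      also have "\<dots> \<le> d * cmod (1 + of_real e * z)"
        using ge[OF \<open>e > 0\<close> \<open>0 \<le> Re z\<close>] that by (intro mult_left_mono) auto
      finally have "cmod (F z) \<le> d * cmod (1 + of_real e * z)"
        using bound[OF \<open>0 \<le> Re z\<close>] by simp
      then show "cmod (F z * \<psi> e z) \<le> d"
        using nz[OF \<open>e > 0\<close> \<open>0 \<le> Re z\<close>] by (simp add: \<psi>_def norm_divide divide_simps)
    qed
  qed (use False assms in auto)
qed (use F_le in auto)

section \<open>Carrying a bound across the real axis\<close>

lemma Re_inverse_ge: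
  assumes "\<bar>Im w\<bar> \<le> Re w" and "w \<noteq> 0"
  shows "1 / (2 * Re w) \<le> Re (1 / w)" and "0 < Re w"
proof -
  show "0 < Re w"
    using assms by (auto simp: complex_eq_iff) 
  have "(Im w)\<^sup>2 \<le> (Re w)\<^sup>2"
    using assms(1) by (metis abs_ge_zero power2_abs power_mono)
  then have "(Re w)\<^sup>2 + (Im w)\<^sup>2 \<le> 2 * (Re w)\<^sup>2"
    by simp
  moreover have "0 < (Re w)\<^sup>2 + (Im w)\<^sup>2"
    using \<open>0 < Re w\<close> by (simp add: add_pos_nonneg)
  ultimately have "Re w / (2 * (Re w)\<^sup>2) \<le> Re w / ((Re w)\<^sup>2 + (Im w)\<^sup>2)"
    using \<open>0 < Re w\<close> by (intro divide_left_mono) auto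
  then show "1 / (2 * Re w) \<le> Re (1 / w)"
    using \<open>0 < Re w\<close> by (simp add: Re_divide power2_eq_square)
qed

text \<open>On the sector of half-angle pi/4 the factor serves three ends: it cancels a bound
  \<open>exp (Q / Re w)\<close>, it never enlarges, and it vanishes at the apex, which makes the
  damped function continuous there. The 2 compensates for the 2 in
  \<open>Re (1 / w) \<ge> 1 / (2 * Re w)\<close>.\<close>

lemma cmod_exp_neg_inverse_le:
  assumes "\<bar>Im w\<bar> \<le> Re w" and "w \<noteq> 0" and "0 < Q"
  shows "cmod (exp (- of_real (2 * Q) / w)) \<le> exp (- Q / Re w)"
    and "cmod (exp (- of_real (2 * Q) / w)) \<le> 1"
    and "cmod (exp (- of_real (2 * Q) / w)) \<le> cmod w / Q"
proof -
  have Re: "Re (- of_real (2 * Q) / w) = - 2 * Q * Re (1 / w)"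
    by (simp add: Re_divide)
  have "- 2 * Q * Re (1 / w) \<le> - 2 * Q * (1 / (2 * Re w))"
    using Re_inverse_ge(1)[OF assms(1,2)] \<open>0 < Q\<close> by (intro mult_left_mono_neg) auto
  then show 1: "cmod (exp (- of_real (2 * Q) / w)) \<le> exp (- Q / Re w)"
    unfolding norm_exp_eq_Re Re by simp
  have pos: "0 < Re w"
    using Re_inverse_ge(2)[OF assms(1,2)] .
  then show "cmod (exp (- of_real (2 * Q) / w)) \<le> 1"
    using \<open>0 < Q\<close> by (intro order_trans[OF 1]) simp
  have "Q / Re w \<le> exp (Q / Re w)"
    using exp_ge_add_one_self[of "Q / Re w"] by linarith
  then have "exp (- Q / Re w) \<le> Re w / Q"
    using pos \<open>0 < Q\<close> by (simp add: exp_minus field_simps)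
  also have "\<dots> \<le> cmod w / Q"
    using complex_Re_le_cmod \<open>0 < Q\<close> by (intro divide_right_mono) auto
  finally show "cmod (exp (- of_real (2 * Q) / w)) \<le> cmod w / Q"
    by (rule order_trans[OF 1])
qed

text \<open>On the sides of the square the horizontal distance to the nearer of \<open>a\<close> and
  \<open>b\<close> is exactly \<open>\<bar>Im w\<bar>\<close>, so one of the two damping factors
  cancels \<open>Q / \<bar>Im w\<bar>\<close>, and the maximum principle bounds the damped function
  by \<open>exp P\<close>. At \<open>z\<close> each factor costs at most \<open>2 * Q / d\<close> in
  the exponent, in all \<open>4 * Q / d\<close>.\<close>

lemma cross_real_axis_bound:
  fixes f :: "complex \<Rightarrow> complex" and x d :: real
  assumes "f holomorphic_on UNIV" and "0 < d" and "0 < Q"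
    and bound: "\<And>w. \<bar>Re w - x\<bar> \<le> d \<Longrightarrow> \<bar>Im w\<bar> \<le> d \<Longrightarrow> Im w \<noteq> 0 \<Longrightarrow> cmod (f w) \<le> exp (P + Q / \<bar>Im w\<bar>)"
    and z: "Re z = x" "\<bar>Im z\<bar> < d"
  shows "cmod (f z) \<le> exp (P + 4 * Q / d)"
proof -
  define a b :: complex where "a = of_real (x - d)" and "b = of_real (x + d)"
  define D where "D = {w. \<bar>Re w - x\<bar> + \<bar>Im w\<bar> < d}"
  define K where "K = {w. \<bar>Re w - x\<bar> + \<bar>Im w\<bar> \<le> d}"
  define E where "E w = exp (- of_real (2 * Q) / w)" for w :: complex
  \<comment> \<open>Division by zero would give \<open>E 0 = 1\<close>, so the limit value 0 at the
    vertices is put in by hand.\<close>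
  define G where "G w = (if w = a \<or> w = b then 0 else f w * E (w - a) * E (b - w))" for w
  have "open D"
    unfolding D_def by (intro open_Collect_less continuous_intros)
  have "closed K"
    unfolding K_def by (intro closed_Collect_le continuous_intros)
  have clos: "closure D \<subseteq> K"
    using \<open>closed K\<close> by (intro closure_minimal) (auto simp: D_def K_def)
  have "bounded K"
  proof (rule boundedI)
    fix w assume "w \<in> K"
    then show "cmod w \<le> \<bar>x\<bar> + d"
      using cmod_le[of w] by (auto simp: K_def)
  qed
  then have "compact K"
    using \<open>closed K\<close> by (simp add: compact_eq_bounded_closed)
  have contf: "continuous_on A f" for A
    using assms(1) holomorphic_on_imp_continuous_on continuous_on_subset by blast
  have "compact (f ` K)"
    using contf \<open>compact K\<close> by (rule compact_continuous_image)
  \<comment> \<open>A crude bound, for the continuity of \<open>G\<close> at the two vertices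
    only.\<close>
  then obtain B where "0 < B" and B': "\<forall>v\<in>f ` K. cmod v \<le> B"
    using compact_imp_bounded bounded_pos by metis
  have B: "cmod (f w) \<le> B" if "w \<in> K" for w
    using B' that by blast
  have cone: "\<bar>Im (w - a)\<bar> \<le> Re (w - a)" "\<bar>Im (b - w)\<bar> \<le> Re (b - w)" if "w \<in> K" for w
    using that by (auto simp: a_def b_def K_def)
  have E: "cmod (E v) \<le> exp (- Q / Re v)" "cmod (E v) \<le> 1" "cmod (E v) \<le> cmod v / Q"
    if "\<bar>Im v\<bar> \<le> Re v" "v \<noteq> 0" for v
    unfolding E_def using cmod_exp_neg_inverse_le[OF that \<open>0 < Q\<close>] by auto
  have G_vertex: "cmod (G w) \<le> B / Q * cmod (w - a)" "cmod (G w) \<le> B / Q * cmod (b - w)"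
    if "w \<in> K" for w
  proof -
    show "cmod (G w) \<le> B / Q * cmod (w - a)"
    proof (cases "w = a \<or> w = b")
      case False
      then have "cmod (f w * E (w - a) * E (b - w)) \<le> B * (cmod (w - a) / Q) * 1"
        using B[OF that] E[OF cone(1)[OF that]] E[OF cone(2)[OF that]] \<open>0 < B\<close> \<open>0 < Q\<close>
        unfolding norm_mult by (intro mult_mono) auto
      then show ?thesis
        using False by (simp add: G_def)
    qed (use \<open>0 < B\<close> \<open>0 < Q\<close> in \<open>auto simp: G_def\<close>)
    show "cmod (G w) \<le> B / Q * cmod (b - w)"
    proof (cases "w = a \<or> w = b")
      case False
      then have "cmod (f w * E (w - a) * E (b - w)) \<le> B * 1 * (cmod (b - w) / Q)"
        using B[OF that] E[OF cone(1)[OF that]] E[OF cone(2)[OF that]] \<open>0 < B\<close> \<open>0 < Q\<close>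
        unfolding norm_mult by (intro mult_mono) auto
      then show ?thesis
        using False by (simp add: G_def)
    qed (use \<open>0 < B\<close> \<open>0 < Q\<close> in \<open>auto simp: G_def\<close>)
  qed
  have z_D: "z \<in> D"
    using z by (simp add: D_def)
  have not_vertex: "w \<noteq> a" "w \<noteq> b" if "w \<in> D" for w
    using that by (auto simp: D_def a_def b_def)
  have Gz: "cmod (G z) \<le> exp P"
  proof (rule maximum_modulus_frontier[where S = D and f = G and \<xi> = z])
    show "bounded D"
      using \<open>bounded K\<close> by (rule bounded_subset) (auto simp: D_def K_def)
    show "z \<in> D" by fact
    have "(\<lambda>w. f w * E (w - a) * E (b - w)) holomorphic_on D"
      unfolding E_def using not_vertex holomorphic_on_subset[OF assms(1)]
      by (intro holomorphic_intros) auto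
    then have "G holomorphic_on D"
      by (rule holomorphic_transform) (use not_vertex in \<open>auto simp: G_def\<close>)
    then show "G holomorphic_on interior D"
      using \<open>open D\<close> by (simp add: interior_open)
    have "continuous (at w within K) G" if "w \<in> K" for w
    proof -
      consider "w = a" | "w = b" | "w \<noteq> a" "w \<noteq> b"
        by blast
      then show ?thesis
      proof cases
        case 1
        have "(G \<longlongrightarrow> 0) (at w within K)"
        proof (rule Lim_null_comparison)
          show "\<forall>\<^sub>F w in at w within K. cmod (G w) \<le> B / Q * cmod (w - a)"
            using G_vertex by (auto simp: eventually_at_filter)
          show "((\<lambda>w. B / Q * cmod (w - a)) \<longlongrightarrow> 0) (at w within K)"
            using 1 \<open>0 < Q\<close> by (auto intro!: tendsto_eq_intros)
        qed
        then show ?thesis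
          using 1 by (simp add: continuous_within G_def)
      next
        case 2
        have "(G \<longlongrightarrow> 0) (at w within K)"
        proof (rule Lim_null_comparison)
          show "\<forall>\<^sub>F w in at w within K. cmod (G w) \<le> B / Q * cmod (b - w)"
            using G_vertex by (auto simp: eventually_at_filter)
          show "((\<lambda>w. B / Q * cmod (b - w)) \<longlongrightarrow> 0) (at w within K)"
            using 2 \<open>0 < Q\<close> by (auto intro!: tendsto_eq_intros)
        qed
        then show ?thesis
          using 2 by (simp add: continuous_within G_def)
      next
        case 3
        have "continuous_on (- {a, b}) (\<lambda>w. f w * E (w - a) * E (b - w))"
          unfolding E_def by (intro continuous_intros contf) auto
        then have "continuous_on (- {a, b}) G"
          by (rule continuous_on_eq) (auto simp: G_def)
        moreover have "open (- {a, b})"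
          by (intro open_Compl finite_imp_closed) auto
        ultimately show ?thesis
          using 3 by (simp add: continuous_on_eq_continuous_at continuous_at_imp_continuous_at_within)
      qed
    qed
    then show "continuous_on (closure D) G"
      using clos by (simp add: continuous_on_eq_continuous_within[symmetric] continuous_on_subset)
        (meson continuous_on_eq_continuous_within continuous_on_subset)
    fix w
    assume "w \<in> frontier D"
    then have "w \<in> K" "w \<notin> D"
      using clos \<open>open D\<close> by (auto simp: frontier_def interior_open)
    then have eq: "\<bar>Re w - x\<bar> + \<bar>Im w\<bar> = d"
      by (auto simp: K_def D_def)
    show "cmod (G w) \<le> exp P"
    proof (cases "w = a \<or> w = b")
      case False
      \<comment> \<open>The frontier of the square meets the real axis at the two vertices
        only.\<close>
      have Im: "Im w \<noteq> 0"
        using False eq by (auto simp: a_def b_def complex_eq_iff abs_if split: if_splits)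
      have fw: "cmod (f w) \<le> exp (P + Q / \<bar>Im w\<bar>)"
        using eq Im by (intro bound) auto
      note bounds = E[OF cone(1)[OF \<open>w \<in> K\<close>]] E[OF cone(2)[OF \<open>w \<in> K\<close>]]
      have "cmod (E (w - a)) * cmod (E (b - w)) \<le> exp (- Q / \<bar>Im w\<bar>)"
      proof (cases "Re w \<le> x")
        case True
        have "Re (w - a) = \<bar>Im w\<bar>"
          using True eq by (simp add: a_def)
        then have "cmod (E (w - a)) * cmod (E (b - w)) \<le> exp (- Q / \<bar>Im w\<bar>) * 1"
          using bounds False by (intro mult_mono) auto
        then show ?thesis by simp
      next
        case gt: False
        have "Re (b - w) = \<bar>Im w\<bar>"
          using gt eq by (simp add: b_def)
        then have "cmod (E (w - a)) * cmod (E (b - w)) \<le> 1 * exp (- Q / \<bar>Im w\<bar>)"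
          using bounds False by (intro mult_mono) auto
        then show ?thesis by simp
      qed
      with fw have "cmod (f w) * (cmod (E (w - a)) * cmod (E (b - w)))
          \<le> exp (P + Q / \<bar>Im w\<bar>) * exp (- Q / \<bar>Im w\<bar>)"
        by (intro mult_mono) auto
      then show ?thesis
        using False by (simp add: G_def norm_mult mult.assoc mult_exp_exp)
    qed (simp add: G_def)
  qed
  \<comment> \<open>\<open>z\<close> lies on the vertical diagonal, at distance at least
    \<open>d\<close> from both vertices, so the damping can be undone there at a controlled
    price.\<close>
  have E_lower: "exp (- 2 * Q / d) \<le> cmod (E v)" if "d \<le> cmod v" for v
  proof -
    have "Re (1 / v) \<le> cmod (1 / v)"
      by (rule complex_Re_le_cmod)
    also have "\<dots> \<le> 1 / d"
      using that \<open>0 < d\<close> by (simp add: norm_divide frac_le)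
    finally have "2 * Q * Re (1 / v) \<le> 2 * Q * (1 / d)"
      using \<open>0 < Q\<close> by (intro mult_left_mono) auto
    moreover have "Re (- of_real (2 * Q) / v) = - (2 * Q * Re (1 / v))"
      by (simp add: Re_divide)
    ultimately show ?thesis
      by (simp add: E_def)
  qed
  have "d \<le> cmod (z - a)" "d \<le> cmod (b - z)"
    using complex_Re_le_cmod[of "z - a"] complex_Re_le_cmod[of "b - z"] z by (auto simp: a_def b_def)
  then have "cmod (f z) * (exp (- 2 * Q / d) * exp (- 2 * Q / d)) \<le> cmod (f z) * (cmod (E (z - a)) * cmod (E (b - z)))"
    by (intro mult_left_mono mult_mono E_lower) auto
  also have "\<dots> = cmod (G z)"
    using not_vertex[OF z_D] by (simp add: G_def norm_mult)
  finally have "cmod (f z) * (exp (- 2 * Q / d) * exp (- 2 * Q / d)) \<le> exp P"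
    using Gz by simp
  then have "cmod (f z) * exp (- (4 * Q / d)) \<le> exp P"
    by (simp add: mult_exp_exp)
  then have "cmod (f z) * exp (- (4 * Q / d)) * exp (4 * Q / d) \<le> exp P * exp (4 * Q / d)"
    by (intro mult_right_mono) auto
  then show ?thesis
    by (simp add: mult.assoc mult_exp_exp)
qed

section \<open>Entire functions bounded off the real axis\<close>

text \<open>The growth that a nonnegative harmonic majorant of \<open>log |f|\<close> permits off the real axis.\<close>

definition axis_growth :: "(complex \<Rightarrow> complex) \<Rightarrow> real \<Rightarrow> bool" where
  "axis_growth f c \<longleftrightarrow> (\<forall>e>0. \<exists>R. \<forall>z. R \<le> cmod z \<longrightarrow> Im z \<noteq> 0 \<longrightarrow>
     cmod (f z) \<le> exp (c * \<bar>Im z\<bar> + e * (cmod z)\<^sup>2 / \<bar>Im z\<bar>))"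

lemma axis_growthD:
  assumes "axis_growth f c" and "e > 0"
  obtains R where "R > 0" and "\<And>z. R \<le> cmod z \<Longrightarrow> Im z \<noteq> 0 \<Longrightarrow>
     cmod (f z) \<le> exp (c * \<bar>Im z\<bar> + e * (cmod z)\<^sup>2 / \<bar>Im z\<bar>)"
proof -
  obtain R where R: "\<forall>z. R \<le> cmod z \<longrightarrow> Im z \<noteq> 0 \<longrightarrow>
     cmod (f z) \<le> exp (c * \<bar>Im z\<bar> + e * (cmod z)\<^sup>2 / \<bar>Im z\<bar>)"
    using assms unfolding axis_growth_def by blast
  show ?thesis
    by (rule that[of "max R 1"]) (use R in auto)
qed

text \<open>This is type zero along the real axis. On the square of half-diagonal
  \<open>d = \<delta> * \<bar>x\<bar>\<close> about \<open>x\<close>,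
  \<open>cross_real_axis_bound\<close> with \<open>Q = 4 * e * x\<^sup>2\<close> gives the exponent
  \<open>(c * \<delta> + 16 * e / \<delta>) * \<bar>x\<bar>\<close>. First \<delta> and then
  \<open>e\<close> is chosen to make each term at most \<open>\<eta> / 2\<close>.\<close>

lemma axis_growth_near_axis:
  assumes "f holomorphic_on UNIV" and "axis_growth f c" and "0 \<le> c" and "0 < \<eta>"
  obtains \<delta> R where "0 < \<delta>" and "0 < R"
    and "\<And>z. R \<le> \<bar>Re z\<bar> \<Longrightarrow> \<bar>Im z\<bar> < \<delta> * \<bar>Re z\<bar> \<Longrightarrow> cmod (f z) \<le> exp (\<eta> * \<bar>Re z\<bar>)"
proof -
  \<comment> \<open>The 1/2 keeps the square within
    \<open>\<bar>Re w\<bar> \<ge> \<bar>x\<bar> / 2\<close>; the denominator has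
    \<open>c + 1\<close> because \<open>c\<close> may be 0.\<close>
  define \<delta> where "\<delta> = min (1 / 2) (\<eta> / (2 * (c + 1)))"
  have "0 < \<delta>"
    using assms by (simp add: \<delta>_def)
  have "\<delta> \<le> 1 / 2" "\<delta> \<le> \<eta> / (2 * (c + 1))"
    unfolding \<delta>_def by (rule min.cobounded1, rule min.cobounded2)
  then have "\<delta> * (2 * (c + 1)) \<le> \<eta>"
    using \<open>0 \<le> c\<close> by (subst (asm) pos_le_divide_eq) auto
  then have \<delta>c: "c * \<delta> \<le> \<eta> / 2"
    using \<open>0 < \<delta>\<close> by (simp add: algebra_simps)
  \<comment> \<open>Makes \<open>16 * e / \<delta>\<close> equal to
    \<open>\<eta> / 2\<close>.\<close>
  define e where "e = \<eta> * \<delta> / 32"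
  have "0 < e"
    using \<open>0 < \<delta>\<close> \<open>0 < \<eta>\<close> by (simp add: e_def)
  obtain R where "R > 0" and R: "\<And>z. R \<le> cmod z \<Longrightarrow> Im z \<noteq> 0 \<Longrightarrow>
     cmod (f z) \<le> exp (c * \<bar>Im z\<bar> + e * (cmod z)\<^sup>2 / \<bar>Im z\<bar>)"
    using axis_growthD[OF assms(2) \<open>0 < e\<close>] by metis
  show ?thesis
  proof (rule that[OF \<open>0 < \<delta>\<close>])
    show "0 < 2 * R"
      using \<open>R > 0\<close> by simp
    fix z
    define x where "x = Re z"
    define d where "d = \<delta> * \<bar>x\<bar>"
    assume "2 * R \<le> \<bar>Re z\<bar>" and Im_z: "\<bar>Im z\<bar> < \<delta> * \<bar>Re z\<bar>"
    then have x: "2 * R \<le> \<bar>x\<bar>" "0 < \<bar>x\<bar>"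
      using \<open>R > 0\<close> by (auto simp: x_def)
    have "0 < d"
      using x \<open>0 < \<delta>\<close> by (simp add: d_def)
    have "d \<le> 1 / 2 * \<bar>x\<bar>"
      unfolding d_def using \<open>\<delta> \<le> 1 / 2\<close> by (intro mult_right_mono) auto
    then have d_le: "d \<le> \<bar>x\<bar> / 2"
      by simp
    have "cmod (f z) \<le> exp (c * d + 4 * (4 * e * x\<^sup>2) / d)"
    proof (rule cross_real_axis_bound[OF assms(1) \<open>0 < d\<close>])
      show "0 < 4 * e * x\<^sup>2"
        using \<open>0 < e\<close> x by simp
      show "Re z = x" "\<bar>Im z\<bar> < d"
        using Im_z by (auto simp: x_def d_def)
      fix w
      assume w: "\<bar>Re w - x\<bar> \<le> d" "\<bar>Im w\<bar> \<le> d" "Im w \<noteq> 0"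
      have "\<bar>x\<bar> / 2 \<le> \<bar>Re w\<bar>" "\<bar>Re w\<bar> \<le> 3 / 2 * \<bar>x\<bar>"
        using w(1) d_le by linarith+
      then have "R \<le> cmod w" and w_le: "cmod w \<le> 2 * \<bar>x\<bar>"
        using abs_Re_le_cmod[of w] cmod_le[of w] w(2) d_le x by linarith+
      have "e * (cmod w)\<^sup>2 / \<bar>Im w\<bar> \<le> e * (2 * \<bar>x\<bar>)\<^sup>2 / \<bar>Im w\<bar>"
        using w_le \<open>0 < e\<close> by (intro divide_right_mono mult_left_mono power_mono) auto
      moreover have "c * \<bar>Im w\<bar> \<le> c * d"
        using w(2) \<open>0 \<le> c\<close> by (rule mult_left_mono)
      ultimately have "exp (c * \<bar>Im w\<bar> + e * (cmod w)\<^sup>2 / \<bar>Im w\<bar>) \<le> exp (c * d + 4 * e * x\<^sup>2 / \<bar>Im w\<bar>)"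
        by (simp add: power_mult_distrib algebra_simps)
      then show "cmod (f w) \<le> exp (c * d + 4 * e * x\<^sup>2 / \<bar>Im w\<bar>)"
        by (rule order_trans[OF R[OF \<open>R \<le> cmod w\<close> w(3)]])
    qed
    also have "c * d + 4 * (4 * e * x\<^sup>2) / d \<le> \<eta> * \<bar>x\<bar>"
    proof -
      have "x\<^sup>2 = \<bar>x\<bar> * \<bar>x\<bar>"
        by (simp add: power2_eq_square)
      then have eq: "4 * (4 * e * x\<^sup>2) / d = \<eta> / 2 * \<bar>x\<bar>"
        using x \<open>0 < \<delta>\<close> by (simp add: e_def d_def del: abs_mult_self_eq)
      have "c * d \<le> \<eta> / 2 * \<bar>x\<bar>"
        unfolding d_def mult.assoc[symmetric] using \<delta>c by (intro mult_right_mono) auto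
      then have "c * d + 4 * (4 * e * x\<^sup>2) / d \<le> \<eta> / 2 * \<bar>x\<bar> + \<eta> / 2 * \<bar>x\<bar>"
        by (rule add_mono) (rule eq_refl[OF eq])
      also have "\<dots> = \<eta> * \<bar>x\<bar>"
        by simp
      finally show ?thesis .
    qed
    finally show "cmod (f z) \<le> exp (\<eta> * \<bar>Re z\<bar>)"
      by (simp add: x_def)
  qed
qed

text \<open>In a cone about the real axis the previous lemma applies with rate 1. Outside it
  \<open>cmod z \<le> (1 + 1 / \<delta>) * \<bar>Im z\<bar>\<close>, which makes
  \<open>(cmod z)\<^sup>2 / \<bar>Im z\<bar>\<close> at most a multiple of
  \<open>cmod z\<close>.\<close>

lemma axis_growth_exponential_type:
  assumes "f holomorphic_on UNIV" and "axis_growth f c" and "0 \<le> c"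
  obtains C where "\<And>z. cmod (f z) \<le> C * exp (C * cmod z)"
proof -
  obtain \<delta> R where "0 < \<delta>" "0 < R"
    and near: "\<And>z. R \<le> \<bar>Re z\<bar> \<Longrightarrow> \<bar>Im z\<bar> < \<delta> * \<bar>Re z\<bar> \<Longrightarrow> cmod (f z) \<le> exp (1 * \<bar>Re z\<bar>)"
    using axis_growth_near_axis[OF assms zero_less_one] by metis
  obtain R' where "R' > 0" and far: "\<And>z. R' \<le> cmod z \<Longrightarrow> Im z \<noteq> 0 \<Longrightarrow>
     cmod (f z) \<le> exp (c * \<bar>Im z\<bar> + 1 * (cmod z)\<^sup>2 / \<bar>Im z\<bar>)"
    using axis_growthD[OF assms(2) zero_less_one] by metis
  \<comment> \<open>In the cone \<open>\<bar>Re z\<bar> + \<bar>Im z\<bar> \<le> (1 + \<delta>) *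
    \<bar>Re z\<bar>\<close>, so \<open>cmod z \<ge> R * (1 + \<delta>)\<close> forces
    \<open>\<bar>Re z\<bar> \<ge> R\<close>.\<close>
  define r where "r = max (R * (1 + \<delta>)) R'"
  have "0 < r"
    using \<open>R' > 0\<close> by (simp add: r_def)
  have "compact (f ` cball 0 r)"
    using holomorphic_on_imp_continuous_on[OF assms(1)]
    by (intro compact_continuous_image) (auto intro: continuous_on_subset)
  then obtain B where "0 < B" and B: "\<forall>v\<in>f ` cball 0 r. cmod v \<le> B"
    using compact_imp_bounded bounded_pos by metis
  define k where "k = c + (1 + 1 / \<delta>)"
  have "1 \<le> k"
    using \<open>0 \<le> c\<close> \<open>0 < \<delta>\<close> by (simp add: k_def)
  have bound: "cmod (f z) \<le> exp (k * cmod z)" if "r \<le> cmod z" for z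
  proof (cases "\<bar>Im z\<bar> < \<delta> * \<bar>Re z\<bar>")
    case True
    have "R * (1 + \<delta>) \<le> \<bar>Re z\<bar> + \<bar>Im z\<bar>"
      using that cmod_le[of z] by (simp add: r_def)
    also have "\<dots> \<le> \<bar>Re z\<bar> * (1 + \<delta>)"
      using True by (simp add: algebra_simps)
    finally have "R \<le> \<bar>Re z\<bar>"
      using \<open>0 < \<delta>\<close> by simp
    then have "cmod (f z) \<le> exp \<bar>Re z\<bar>"
      using near True by simp
    also have "\<bar>Re z\<bar> \<le> 1 * cmod z"
      using abs_Re_le_cmod[of z] by simp
    also have "\<dots> \<le> k * cmod z"
      using \<open>1 \<le> k\<close> by (intro mult_right_mono) auto
    finally show ?thesis
      by simp
  next
    case False
    then have "\<bar>Re z\<bar> \<le> 1 / \<delta> * \<bar>Im z\<bar>"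
      using \<open>0 < \<delta>\<close> by (simp add: field_simps)
    then have le: "cmod z \<le> (1 + 1 / \<delta>) * \<bar>Im z\<bar>"
      using cmod_le[of z] by (simp add: algebra_simps)
    have "0 < cmod z"
      using that \<open>0 < r\<close> by linarith
    with le have "Im z \<noteq> 0"
      by (auto simp del: zero_less_norm_iff)
    have "cmod z * cmod z \<le> (1 + 1 / \<delta>) * \<bar>Im z\<bar> * cmod z"
      using le by (intro mult_right_mono) auto
    then have "(cmod z)\<^sup>2 \<le> (1 + 1 / \<delta>) * cmod z * \<bar>Im z\<bar>"
      by (simp only: power2_eq_square mult.assoc mult.commute[of "cmod z" "\<bar>Im z\<bar>"])
    moreover have "0 < \<bar>Im z\<bar>"
      using \<open>Im z \<noteq> 0\<close> by simp
    ultimately have "(cmod z)\<^sup>2 / \<bar>Im z\<bar> \<le> (1 + 1 / \<delta>) * cmod z"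
      by (simp only: pos_divide_le_eq)
    moreover have "c * \<bar>Im z\<bar> \<le> c * cmod z"
      using abs_Im_le_cmod \<open>0 \<le> c\<close> by (rule mult_left_mono)
    ultimately have le: "exp (c * \<bar>Im z\<bar> + 1 * (cmod z)\<^sup>2 / \<bar>Im z\<bar>) \<le> exp (k * cmod z)"
      unfolding k_def by (simp add: distrib_right)
    have "R' \<le> cmod z"
      using that by (simp add: r_def)
    from far[OF this \<open>Im z \<noteq> 0\<close>] le show ?thesis
      by (rule order_trans)
  qed
  show ?thesis
  proof (rule that[of "max B k"])
    fix z
    show "cmod (f z) \<le> max B k * exp (max B k * cmod z)"
    proof (cases "cmod z \<le> r")
      case True
      then have "cmod (f z) \<le> B * 1"
        using B by auto
      also have "\<dots> \<le> max B k * exp (max B k * cmod z)"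
        using \<open>0 < B\<close> \<open>1 \<le> k\<close> by (intro mult_mono) (auto simp: le_max_iff_disj)
      finally show ?thesis .
    next
      case False
      then have "cmod (f z) \<le> 1 * exp (k * cmod z)"
        using bound by simp
      also have "\<dots> \<le> max B k * exp (max B k * cmod z)"
        using \<open>0 < B\<close> \<open>1 \<le> k\<close> by (intro mult_mono) (auto simp: le_max_iff_disj intro!: mult_right_mono)
      finally show ?thesis .
    qed
  qed
qed

section \<open>From exponential type to linear growth\<close>

lemma one_plus_le_cmod:
  assumes "0 \<le> Re z"
  shows "1 + cmod z \<le> 2 * cmod (z + 1)" and "1 \<le> cmod (z + 1)"
proof -
  show "1 \<le> cmod (z + 1)"
    using complex_Re_le_cmod[of "z + 1"] assms by simp
  moreover have "(cmod z)\<^sup>2 \<le> (cmod (z + 1))\<^sup>2"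
    using power_mono[of "Re z" "Re z + 1" 2] assms by (simp add: cmod_power2)
  then have "cmod z \<le> cmod (z + 1)"
    by (rule power2_le_imp_le) simp
  ultimately show "1 + cmod z \<le> 2 * cmod (z + 1)"
    by simp
qed

text \<open>Dividing by \<open>z + 1\<close> absorbs the linear growth on the imaginary axis, where
  the exponential factor has modulus 1; on the positive real axis that factor cancels the growth
  \<open>exp (\<eta> * Re z)\<close>. The bound \<open>K\<close> depends on \<eta>, but mere
  boundedness is what the half-plane principle asks for.\<close>

lemma axis_growth_quadrant_bound:
  assumes "f holomorphic_on UNIV" and "axis_growth f c" and "0 \<le> c" and "0 < \<eta>"
    and imag: "\<And>y. cmod (f (\<i> * of_real y)) \<le> M * (1 + \<bar>y\<bar>)"
  obtains K where "\<And>z. 0 \<le> Re z \<Longrightarrow> 0 \<le> Im z \<Longrightarrow> cmod (f z * exp (- of_real \<eta> * z) / (z + 1)) \<le> K"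
proof -
  obtain \<delta> R where "0 < \<delta>" "0 < R"
    and near: "\<And>z. R \<le> \<bar>Re z\<bar> \<Longrightarrow> \<bar>Im z\<bar> < \<delta> * \<bar>Re z\<bar> \<Longrightarrow> cmod (f z) \<le> exp (\<eta> * \<bar>Re z\<bar>)"
    using axis_growth_near_axis[OF assms(1-4)] by metis
  obtain C where C: "\<And>z. cmod (f z) \<le> C * exp (C * cmod z)"
    using axis_growth_exponential_type[OF assms(1-3)] by metis
  have "0 \<le> M"
    using order_trans[OF norm_ge_zero imag[of 0]] by simp
  have "0 \<le> C"
    using order_trans[OF norm_ge_zero C[of 0]] by simp
  define F where "F z = f z * exp (- of_real \<eta> * z) / (z + 1)" for z
  \<comment> \<open>The three terms cover the imaginary axis, the real axis beyond \<open>R\<close>,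
    and the segment from 0 to \<open>R\<close>.\<close>
  define K where "K = max (2 * M) (max 1 (C * exp (C * R)))"
  have F_norm: "cmod (F z) = cmod (f z) * exp (- \<eta> * Re z) / cmod (z + 1)" for z
    by (simp add: F_def norm_mult norm_divide)
  have F_le: "cmod (F z) \<le> cmod (f z) * exp (- \<eta> * Re z)" if "0 \<le> Re z" for z
  proof -
    have "0 < cmod (z + 1)"
      using one_plus_le_cmod(2)[OF that] by linarith
    then have "cmod (f z) * exp (- \<eta> * Re z) / cmod (z + 1) \<le> cmod (f z) * exp (- \<eta> * Re z) / 1"
      using one_plus_le_cmod(2)[OF that] by (intro divide_left_mono) auto
    then show ?thesis
      unfolding F_norm by simp
  qed
  have nz: "z + 1 \<noteq> 0" if "0 \<le> Re z" for z
    using one_plus_le_cmod(2)[OF that] by auto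
  have F_hol: "F holomorphic_on A" if "A \<subseteq> {z. 0 \<le> Re z}" for A
    unfolding F_def using holomorphic_on_subset[OF assms(1)] nz that by (intro holomorphic_intros) auto
  show ?thesis
  proof (rule that)
    fix z :: complex
    assume "0 \<le> Re z" "0 \<le> Im z"
    have "cmod (F z) \<le> K"
    proof (rule phragmen_lindelof_quadrant[where F = F and z = z])
      show "F holomorphic_on {z. 0 < Re z \<and> 0 < Im z}"
        by (rule F_hol) auto
      show "continuous_on {z. 0 \<le> Re z \<and> 0 \<le> Im z} F"
        by (rule holomorphic_on_imp_continuous_on[OF F_hol]) auto
      show "0 \<le> K"
        by (simp add: K_def le_max_iff_disj)
      show "cmod (F z) \<le> C * exp (C * cmod z)" if "z \<in> {z. 0 \<le> Re z \<and> 0 \<le> Im z}" for z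
      proof -
        have "cmod (F z) \<le> cmod (f z) * exp (- \<eta> * Re z)"
          using F_le that by simp
        also have "\<dots> \<le> cmod (f z) * 1"
          using that \<open>0 < \<eta>\<close> by (intro mult_left_mono) auto
        also have "\<dots> \<le> C * exp (C * cmod z)"
          using C by simp
        finally show ?thesis .
      qed
      show "z \<in> {z. 0 \<le> Re z \<and> 0 \<le> Im z}"
        using \<open>0 \<le> Re z\<close> \<open>0 \<le> Im z\<close> by simp
      show "cmod (F z) \<le> K" if z: "z \<in> {z. 0 \<le> Re z \<and> 0 \<le> Im z}" and "Re z = 0 \<or> Im z = 0" for z
      proof (cases "Re z = 0")
        case True
        then have z_eq: "z = \<i> * of_real (Im z)" and z_norm: "cmod z = \<bar>Im z\<bar>"
          by (auto simp: complex_eq_iff cmod_def)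
        have "cmod (f z) \<le> M * (1 + cmod z)"
          using imag[of "Im z"] z_eq z_norm by simp
        also have "\<dots> \<le> M * (2 * cmod (z + 1))"
          using one_plus_le_cmod(1)[of z] True \<open>0 \<le> M\<close> by (intro mult_left_mono) auto
        finally have "cmod (F z) \<le> 2 * M"
          using nz[of z] True by (simp add: F_norm divide_le_eq algebra_simps)
        then show ?thesis
          by (simp add: K_def)
      next
        case False
        then have "Im z = 0" "0 < Re z"
          using that by auto
        then have z_norm: "cmod z = Re z"
          by (simp add: cmod_def)
        show ?thesis
        proof (cases "R \<le> Re z")
          case True
          then have "cmod (f z) \<le> exp (\<eta> * Re z)"
            using near[of z] \<open>Im z = 0\<close> \<open>0 < Re z\<close> \<open>0 < \<delta>\<close> by simp
          then have "cmod (f z) * exp (- \<eta> * Re z) \<le> exp (\<eta> * Re z) * exp (- \<eta> * Re z)"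
            by (rule mult_right_mono) simp
          then have "cmod (F z) \<le> 1"
            using F_le[of z] \<open>0 < Re z\<close> by (simp add: mult_exp_exp)
          then show ?thesis
            by (simp add: K_def le_max_iff_disj)
        next
          case False
          have "cmod (F z) \<le> cmod (f z) * exp (- \<eta> * Re z)"
            using F_le \<open>0 < Re z\<close> by simp
          also have "\<dots> \<le> C * exp (C * R) * 1"
          proof (intro mult_mono)
            have "C * exp (C * cmod z) \<le> C * exp (C * R)"
              using False z_norm \<open>0 \<le> C\<close> by (auto intro!: mult_left_mono)
            then show "cmod (f z) \<le> C * exp (C * R)"
              using C[of z] by simp
          qed (use \<open>0 < \<eta>\<close> \<open>0 < Re z\<close> \<open>0 \<le> C\<close> in auto)
          finally show ?thesis
            by (simp add: K_def le_max_iff_disj)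
        qed
      qed
    qed
    then show "cmod (f z * exp (- of_real \<eta> * z) / (z + 1)) \<le> K"
      by (simp only: F_def)
  qed
qed

lemma axis_growth_cnj:
  assumes "axis_growth f c"
  shows "axis_growth (\<lambda>z. cnj (f (cnj z))) c"
  unfolding axis_growth_def
proof (intro allI impI)
  fix e :: real assume "e > 0"
  obtain R where R: "\<And>z. R \<le> cmod z \<Longrightarrow> Im z \<noteq> 0 \<Longrightarrow>
     cmod (f z) \<le> exp (c * \<bar>Im z\<bar> + e * (cmod z)\<^sup>2 / \<bar>Im z\<bar>)"
    using axis_growthD[OF assms \<open>e > 0\<close>] by metis
  show "\<exists>R. \<forall>z. R \<le> cmod z \<longrightarrow> Im z \<noteq> 0 \<longrightarrow>
     cmod (cnj (f (cnj z))) \<le> exp (c * \<bar>Im z\<bar> + e * (cmod z)\<^sup>2 / \<bar>Im z\<bar>)"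
    by (rule exI[of _ R]) (use R[of "cnj _"] in auto)
qed

lemma axis_growth_uminus:
  assumes "axis_growth f c"
  shows "axis_growth (\<lambda>z. f (- z)) c"
  unfolding axis_growth_def
proof (intro allI impI)
  fix e :: real assume "e > 0"
  obtain R where R: "\<And>z. R \<le> cmod z \<Longrightarrow> Im z \<noteq> 0 \<Longrightarrow>
     cmod (f z) \<le> exp (c * \<bar>Im z\<bar> + e * (cmod z)\<^sup>2 / \<bar>Im z\<bar>)"
    using axis_growthD[OF assms \<open>e > 0\<close>] by metis
  show "\<exists>R. \<forall>z. R \<le> cmod z \<longrightarrow> Im z \<noteq> 0 \<longrightarrow>
     cmod (f (- z)) \<le> exp (c * \<bar>Im z\<bar> + e * (cmod z)\<^sup>2 / \<bar>Im z\<bar>)"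
    by (rule exI[of _ R]) (use R[of "- _"] in auto)
qed

text \<open>Boundedness in both quadrants admits the half-plane principle, and then the imaginary
  axis alone determines the bound \<open>2 * M\<close>. This no longer depends on \<eta>, which can
  therefore tend to 0.\<close>

lemma axis_growth_right_half_plane:
  fixes z :: complex
  assumes "f holomorphic_on UNIV" and "axis_growth f c" and "0 \<le> c"
    and imag: "\<And>y. cmod (f (\<i> * of_real y)) \<le> M * (1 + \<bar>y\<bar>)"
    and "0 \<le> Re z"
  shows "cmod (f z) \<le> 2 * M * cmod (z + 1)"
proof -
  have "0 \<le> M"
    using order_trans[OF norm_ge_zero imag[of 0]] by simp
  have nz: "z + 1 \<noteq> 0" if "0 \<le> Re z" for z
    using one_plus_le_cmod(2)[OF that] by auto
  have bound: "cmod (f z * exp (- of_real \<eta> * z) / (z + 1)) \<le> 2 * M" if "\<eta> > 0" for \<eta>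
  proof -
    define F where "F z = f z * exp (- of_real \<eta> * z) / (z + 1)" for z
    obtain K1 where K1: "\<And>z. 0 \<le> Re z \<Longrightarrow> 0 \<le> Im z \<Longrightarrow> cmod (F z) \<le> K1"
      using axis_growth_quadrant_bound[OF assms(1-3) \<open>\<eta> > 0\<close> imag, folded F_def] by metis
    \<comment> \<open>Reflection in the real axis carries the lower right quadrant to the upper
      one.\<close>
    define f' where "f' = cnj \<circ> f \<circ> cnj"
    have "f' holomorphic_on UNIV"
      unfolding f'_def
      by (rule holomorphic_on_compose_cnj_cnj) (use assms(1) in \<open>auto intro: holomorphic_on_subset\<close>)
    moreover have "axis_growth f' c"
      using axis_growth_cnj[OF assms(2)] by (simp add: f'_def o_def)
    moreover have "cmod (f' (\<i> * of_real y)) \<le> M * (1 + \<bar>y\<bar>)" for y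
      using imag[of "- y"] by (simp add: f'_def)
    ultimately obtain K2 where K2: "\<And>z. 0 \<le> Re z \<Longrightarrow> 0 \<le> Im z \<Longrightarrow>
        cmod (f' z * exp (- of_real \<eta> * z) / (z + 1)) \<le> K2"
      using axis_growth_quadrant_bound[OF _ _ assms(3) \<open>\<eta> > 0\<close>] by metis
    have F_cnj: "cmod (F z) = cmod (f' (cnj z) * exp (- of_real \<eta> * cnj z) / (cnj z + 1))" for z
    proof -
      have "f' (cnj z) * exp (- of_real \<eta> * cnj z) / (cnj z + 1) = cnj (F z)"
        by (simp add: F_def f'_def exp_cnj)
      then show ?thesis
        by simp
    qed
    have hol: "F holomorphic_on A" if "A \<subseteq> {z. 0 \<le> Re z}" for A
      unfolding F_def using holomorphic_on_subset[OF assms(1)] nz that by (intro holomorphic_intros) auto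
    have "cmod (F z) \<le> 2 * M"
    proof (rule phragmen_lindelof_half_plane[where F = F and z = z])
      show "F holomorphic_on {z. 0 < Re z}"
        by (rule hol) auto
      show "continuous_on {z. 0 \<le> Re z} F"
        by (rule holomorphic_on_imp_continuous_on[OF hol]) auto
      show "cmod (F z) \<le> max K1 K2" if "0 \<le> Re z" for z
      proof (cases "0 \<le> Im z")
        case True
        then show ?thesis
          using K1[OF that] by (simp add: le_max_iff_disj)
      next
        case False
        then show ?thesis
          using K2[of "cnj z"] that unfolding F_cnj by (simp add: le_max_iff_disj)
      qed
      show "cmod (F z) \<le> 2 * M" if "Re z = 0" for z
      proof -
        have z_eq: "z = \<i> * of_real (Im z)" and z_norm: "cmod z = \<bar>Im z\<bar>"
          using that by (auto simp: complex_eq_iff cmod_def)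
        have "cmod (f z) \<le> M * (1 + cmod z)"
          using imag[of "Im z"] z_eq z_norm by simp
        also have "\<dots> \<le> M * (2 * cmod (z + 1))"
          using one_plus_le_cmod(1)[of z] that \<open>0 \<le> M\<close> by (intro mult_left_mono) auto
        finally show ?thesis
          using nz[of z] that by (simp add: F_def norm_mult norm_divide divide_le_eq algebra_simps)
      qed
    qed (use \<open>0 \<le> M\<close> \<open>0 \<le> Re z\<close> in auto)
    then show ?thesis
      by (simp add: F_def)
  qed
  have "((\<lambda>\<eta>. cmod (f z * exp (- of_real \<eta> * z) / (z + 1))) \<longlongrightarrow> cmod (f z * exp (- of_real 0 * z) / (z + 1))) (at_right 0)"
    using nz[OF \<open>0 \<le> Re z\<close>] by (intro tendsto_intros) auto
  then have "cmod (f z * exp (- of_real 0 * z) / (z + 1)) \<le> 2 * M"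
    by (rule tendsto_upperbound) (rule eventually_mono[OF eventually_at_right_less bound], auto)
  then show ?thesis
    using nz[OF \<open>0 \<le> Re z\<close>] by (simp add: norm_divide divide_le_eq)
qed

proposition axis_growth_imp_linear:
  assumes "f holomorphic_on UNIV" and "axis_growth f c" and "0 \<le> c"
    and imag: "\<And>y. cmod (f (\<i> * of_real y)) \<le> M * (1 + \<bar>y\<bar>)"
  obtains \<alpha> \<beta> where "\<And>z. f z = \<alpha> * z + \<beta>"
proof -
  have "0 \<le> M"
    using order_trans[OF norm_ge_zero imag[of 0]] by simp
  have "(\<lambda>z. f (- z)) holomorphic_on UNIV"
    using holomorphic_on_compose[of uminus UNIV f] assms(1) by (simp add: o_def holomorphic_on_minus surj_uminus)
  note right = axis_growth_right_half_plane[OF assms]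
    and left = axis_growth_right_half_plane[OF this axis_growth_uminus[OF assms(2)] assms(3), of M]
  have bound: "cmod (f z) \<le> (4 * M) * cmod z ^ 1" if "1 \<le> cmod z" for z
  proof -
    have tri: "cmod (w + 1) \<le> 2 * cmod z" if "cmod w = cmod z" for w
      using norm_triangle_ineq[of w 1] that \<open>1 \<le> cmod z\<close> by simp
    have "cmod (f z) \<le> 2 * M * cmod (z + 1) \<or> cmod (f z) \<le> 2 * M * cmod (- z + 1)"
    proof (cases "0 \<le> Re z")
      case True
      then show ?thesis
        using right by blast
    next
      case False
      moreover have "cmod (f (- (\<i> * of_real y))) \<le> M * (1 + \<bar>y\<bar>)" for y
        using imag[of "- y"] by simp
      ultimately show ?thesis
        using left[of "- z"] by simp
    qed
    moreover have "2 * M * cmod (z + 1) \<le> 2 * M * (2 * cmod z)" "2 * M * cmod (- z + 1) \<le> 2 * M * (2 * cmod z)"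
      using \<open>0 \<le> M\<close> by (intro mult_left_mono tri; simp)+
    ultimately show ?thesis
      by auto
  qed
  have "f z = deriv f 0 * z + f 0" for z
    using Liouville_polynomial[OF assms(1) bound, where \<xi> = z] by simp
  then show ?thesis
    using that by blast
qed

section \<open>Reflection across the real axis\<close>

text \<open>The modulus of \<open>exp f\<close> depends on \<open>Re f\<close> alone, so Cauchy's
  estimate for \<open>exp f\<close> asks for no bound on \<open>Im f\<close>. Dividing by
  \<open>cmod (exp (f z)) \<ge> exp (- A)\<close> costs the second factor
  \<open>exp A\<close>.\<close>

lemma norm_deriv_le_of_Re_bounded:
  assumes "f holomorphic_on S" and "cball z r \<subseteq> S" and "0 < r"
    and bound: "\<And>w. w \<in> cball z r \<Longrightarrow> \<bar>Re (f w)\<bar> \<le> A"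
  shows "cmod (deriv f z) \<le> exp (2 * A) / r"
proof -
  have hol: "f holomorphic_on cball z r"
    using assms(1,2) by (rule holomorphic_on_subset)
  then have hol_ball: "f holomorphic_on ball z r"
    by (rule holomorphic_on_subset) auto
  have "cmod ((deriv ^^ 1) (\<lambda>w. exp (f w)) z) \<le> fact 1 * exp A / r ^ 1"
  proof (rule Cauchy_inequality)
    show "(\<lambda>w. exp (f w)) holomorphic_on ball z r"
      using hol_ball by (intro holomorphic_intros)
    show "continuous_on (cball z r) (\<lambda>w. exp (f w))"
      using holomorphic_on_imp_continuous_on[OF hol] by (intro continuous_intros)
    show "cmod (exp (f w)) \<le> exp A" if "cmod (z - w) = r" for w
      using bound[of w] that by (auto simp: dist_norm)
  qed fact
  moreover have "deriv (\<lambda>w. exp (f w)) z = exp (f z) * deriv f z"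
    using holomorphic_derivI[OF hol_ball open_ball, of z] \<open>0 < r\<close>
    by (intro DERIV_imp_deriv DERIV_fun_exp) auto
  ultimately have "exp (Re (f z)) * cmod (deriv f z) \<le> exp A / r"
    by (simp add: norm_mult)
  moreover have "exp (- A) * cmod (deriv f z) \<le> exp (Re (f z)) * cmod (deriv f z)"
    using bound[of z] \<open>0 < r\<close> by (intro mult_right_mono) auto
  ultimately have "exp A * (exp (- A) * cmod (deriv f z)) \<le> exp A * (exp A / r)"
    by (intro mult_left_mono) auto
  then show ?thesis
    by (simp add: mult_exp_exp flip: mult.assoc)
qed

section \<open>Boundary behaviour of the function and of its primitive\<close>

lemma vertical_derivative:
  assumes "(f has_field_derivative D) (at (Complex x s))"
  shows "((\<lambda>s. f (Complex x s)) has_vector_derivative \<i> * D) (at s)"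
proof -
  have "((\<lambda>s. of_real x + \<i> * of_real s) has_vector_derivative \<i>) (at s)"
    by (auto intro!: derivative_eq_intros)
  moreover have "Complex x = (\<lambda>s. of_real x + \<i> * of_real s)"
    by (simp add: fun_eq_iff Complex_eq)
  ultimately have "(Complex x has_vector_derivative \<i>) (at s)"
    by simp
  from field_vector_diff_chain_at[OF this assms] show ?thesis
    by (simp add: o_def)
qed

lemma horizontal_derivative:
  assumes "(f has_field_derivative D) (at (Complex t s))"
  shows "((\<lambda>t. f (Complex t s)) has_vector_derivative D) (at t)"
proof -
  have "((\<lambda>t. of_real t + \<i> * of_real s) has_vector_derivative 1) (at t)"
    by (auto intro!: derivative_eq_intros)
  then have "((\<lambda>t. Complex t s) has_vector_derivative 1) (at t)"
    by (simp add: Complex_eq)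
  from field_vector_diff_chain_at[OF this assms] show ?thesis
    by (simp add: o_def)
qed

lemma shift_up_LIMSEQ: "(\<lambda>n. z + \<i> / of_nat (Suc n)) \<longlonglongrightarrow> z"
  using tendsto_add[OF tendsto_const[of z] tendsto_mult[OF tendsto_const[of \<i>] LIMSEQ_inverse_real_of_nat[THEN tendsto_of_real]]]
  by (simp add: inverse_eq_divide)

lemma half_box_eq_cbox:
  "{z. \<bar>Re z\<bar> \<le> R \<and> 0 \<le> Im z \<and> Im z \<le> H} = cbox (Complex (- R) 0) (Complex R H)"
  by (auto simp: in_cbox_complex_iff)

context
  fixes f :: "complex \<Rightarrow> complex"
  assumes f_hol: "f holomorphic_on upper_half_plane"
    and Re_f_lim: "\<And>x::real. ((\<lambda>z. Re (f z)) \<longlongrightarrow> 0) (at (of_real x) within upper_half_plane)"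
begin

text \<open>The value 0 on the axis is the limit given by \<open>Re_f_lim\<close>; it makes
  \<open>u\<close> continuous on the closed half-plane, where compactness yields bounds and uniform
  continuity.\<close>

private definition "u z = (if 0 < Im z then Re (f z) else 0)"

private lemma f_deriv: "(f has_field_derivative deriv f z) (at z)" if "0 < Im z"
  using holomorphic_derivI[OF f_hol open_upper_half_plane, of z] that by (simp add: upper_half_plane_def)

private lemma f_isCont: "isCont f z" if "0 < Im z"
  using f_deriv[OF that] by (rule DERIV_isCont)

private lemma u_continuous: "continuous_on {z. 0 \<le> Im z} u"
  unfolding continuous_on_eq_continuous_within
proof
  fix z :: complex
  assume "z \<in> {z. 0 \<le> Im z}"
  then consider "0 < Im z" | "Im z = 0"
    by fastforce
  then show "continuous (at z within {z. 0 \<le> Im z}) u"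
  proof cases
    case 1
    have "isCont (\<lambda>z. Re (f z)) z"
      using f_isCont[OF 1] by (rule continuous_Re)
    moreover have "\<forall>\<^sub>F w in nhds z. w \<in> {w. 0 < Im w}"
      using 1 open_halfspace_Im_gt by (intro eventually_nhds_in_open) auto
    then have "\<forall>\<^sub>F w in nhds z. Re (f w) = u w"
      by eventually_elim (simp add: u_def)
    ultimately have "isCont u z"
      using isCont_cong by fastforce
    then show ?thesis
      by (rule continuous_at_imp_continuous_at_within)
  next
    case 2
    then have "z = of_real (Re z)"
      by (simp add: complex_eq_iff)
    then have "((\<lambda>z. Re (f z)) \<longlongrightarrow> 0) (at z within upper_half_plane)"
      using Re_f_lim[of "Re z"] by simp
    then have "(u \<longlongrightarrow> 0) (at z within upper_half_plane)"
      by (rule Lim_transform_eventually) (auto simp: eventually_at_filter u_def upper_half_plane_def)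
    moreover have "(u \<longlongrightarrow> 0) (at z within {z. Im z = 0})"
      by (rule tendsto_eventually) (auto simp: eventually_at_filter u_def)
    ultimately have "(u \<longlongrightarrow> 0) (at z within upper_half_plane \<union> {z. Im z = 0})"
      by (rule Lim_Un)
    moreover have "upper_half_plane \<union> {z. Im z = 0} = {z. 0 \<le> Im z}"
      by (auto simp: upper_half_plane_def)
    ultimately show ?thesis
      using 2 by (simp add: continuous_within u_def)
  qed
qed

private lemma Re_f_bounded:
  obtains A where "\<And>z. \<bar>Re z\<bar> \<le> R \<Longrightarrow> 0 < Im z \<Longrightarrow> Im z \<le> H \<Longrightarrow> \<bar>Re (f z)\<bar> \<le> A"
proof -
  have "continuous_on {z. \<bar>Re z\<bar> \<le> R \<and> 0 \<le> Im z \<and> Im z \<le> H} u"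
    using u_continuous by (rule continuous_on_subset) auto
  then have "compact (u ` {z. \<bar>Re z\<bar> \<le> R \<and> 0 \<le> Im z \<and> Im z \<le> H})"
    unfolding half_box_eq_cbox by (intro compact_continuous_image) auto
  then obtain A where "\<forall>v\<in>u ` {z. \<bar>Re z\<bar> \<le> R \<and> 0 \<le> Im z \<and> Im z \<le> H}. norm v \<le> A"
    using compact_imp_bounded bounded_iff by metis
  then have "\<bar>Re (f z)\<bar> \<le> A" if "\<bar>Re z\<bar> \<le> R" "0 < Im z" "Im z \<le> H" for z
    using that by (force simp: u_def)
  then show ?thesis
    using that by blast
qed

text \<open>Cauchy's estimate for \<open>exp f\<close> bounds \<open>deriv f\<close> by \<open>O(1 / Im z)\<close>, so \<open>f\<close> grows
  logarithmically at the axis; the weaker power bound is all that is needed.\<close>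

private lemma f_le:
  assumes "0 \<le> R"
  obtains C where "0 \<le> C"
    and "\<And>z. \<bar>Re z\<bar> \<le> R \<Longrightarrow> 0 < Im z \<Longrightarrow> Im z \<le> 1 \<Longrightarrow> cmod (f z) \<le> C / sqrt (Im z)"
proof -
  \<comment> \<open>The margins leave room for the disc of radius \<open>Im z / 2\<close> about a
    point with \<open>\<bar>Re z\<bar> \<le> R\<close> and \<open>Im z \<le> 1\<close>.\<close>
  obtain A where A: "\<And>z. \<bar>Re z\<bar> \<le> R + 1 \<Longrightarrow> 0 < Im z \<Longrightarrow> Im z \<le> 2 \<Longrightarrow> \<bar>Re (f z)\<bar> \<le> A"
    using Re_f_bounded[of "R + 1" 2] by metis
  define B where "B = 2 * exp (2 * A)"
  have "0 \<le> B"
    by (simp add: B_def)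
  have deriv_le: "cmod (deriv f z) \<le> B / Im z" if "\<bar>Re z\<bar> \<le> R" "0 < Im z" "Im z \<le> 1" for z
  proof -
    have near: "\<bar>Re w\<bar> \<le> \<bar>Re z\<bar> + Im z / 2" "Im z / 2 \<le> Im w" "Im w \<le> 3 / 2 * Im z"
      if "w \<in> cball z (Im z / 2)" for w
    proof -
      have "cmod (w - z) \<le> Im z / 2"
        using that by (simp add: dist_norm norm_minus_commute)
      then have "\<bar>Re w - Re z\<bar> \<le> Im z / 2" "\<bar>Im w - Im z\<bar> \<le> Im z / 2"
        using abs_Re_le_cmod[of "w - z"] abs_Im_le_cmod[of "w - z"] by auto
      then show "\<bar>Re w\<bar> \<le> \<bar>Re z\<bar> + Im z / 2" "Im z / 2 \<le> Im w" "Im w \<le> 3 / 2 * Im z"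
        by arith+
    qed
    have "cmod (deriv f z) \<le> exp (2 * A) / (Im z / 2)"
    proof (rule norm_deriv_le_of_Re_bounded[OF f_hol])
      show "cball z (Im z / 2) \<subseteq> upper_half_plane"
      proof
        fix w assume "w \<in> cball z (Im z / 2)"
        then show "w \<in> upper_half_plane"
          using near(2)[of w] \<open>0 < Im z\<close> by (simp add: upper_half_plane_def)
      qed
      show "\<bar>Re (f w)\<bar> \<le> A" if w: "w \<in> cball z (Im z / 2)" for w
      proof (rule A)
        show "\<bar>Re w\<bar> \<le> R + 1" "0 < Im w" "Im w \<le> 2"
          using near[OF w] \<open>\<bar>Re z\<bar> \<le> R\<close> \<open>0 < Im z\<close> \<open>Im z \<le> 1\<close> by linarith+
      qed
    qed (use that in simp)
    then show ?thesis
      by (simp add: B_def mult.commute)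
  qed
  have "continuous_on (cbox (- R) R) (\<lambda>x. f (Complex x 1))"
  proof (rule continuous_at_imp_continuous_on, rule ballI)
    fix x
    show "isCont (\<lambda>x. f (Complex x 1)) x"
      using horizontal_derivative[OF f_deriv[of "Complex x 1"]] by (intro has_vector_derivative_continuous) auto
  qed
  then have "compact ((\<lambda>x. f (Complex x 1)) ` cbox (- R) R)"
    by (intro compact_continuous_image) auto
  then obtain C0 where C0': "\<forall>v\<in>(\<lambda>x. f (Complex x 1)) ` cbox (- R) R. norm v \<le> C0"
    using compact_imp_bounded bounded_iff by metis
  then have C0: "cmod (f (Complex x 1)) \<le> C0" if "\<bar>x\<bar> \<le> R" for x
    using that by (force simp: abs_le_iff)
  have "0 \<le> C0"
    using order_trans[OF norm_ge_zero C0[of 0]] assms by simp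
  show ?thesis
  proof (rule that[of "C0 + 2 * B"])
    show "0 \<le> C0 + 2 * B"
      using \<open>0 \<le> C0\<close> \<open>0 \<le> B\<close> by simp
    fix z
    assume z: "\<bar>Re z\<bar> \<le> R" "0 < Im z" "Im z \<le> 1"
    define x y where "x = Re z" and "y = Im z"
    have xy: "\<bar>x\<bar> \<le> R" "0 < y" "y \<le> 1" "z = Complex x y"
      using z by (auto simp: x_def y_def)
    have sqrt: "0 < sqrt y" "sqrt y \<le> 1"
      using xy by auto
    have "cmod (f (Complex x 1) - f (Complex x y)) \<le> 2 * B / sqrt y"
    proof (cases "y = 1")
      case True
      then show ?thesis
        using \<open>0 \<le> B\<close> by simp
    next
      case False
      then have "y < 1"
        using xy by simp
      \<comment> \<open>Since \<open>s < 1\<close>, the derivative bound \<open>B / s\<close> may be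
        weakened to \<open>B / (s * sqrt s)\<close>, whose primitive \<open>- 2 * B / sqrt s\<close>
        takes the place of a logarithm.\<close>
      have "norm (f (Complex x 1) - f (Complex x y)) \<le> - 2 * B / sqrt 1 - (- 2 * B / sqrt y)"
      proof (rule differentiable_bound_general[OF \<open>y < 1\<close>])
        have vd: "((\<lambda>s. f (Complex x s)) has_vector_derivative \<i> * deriv f (Complex x s)) (at s)" if "0 < s" for s
          using that by (intro vertical_derivative f_deriv) auto
        show "((\<lambda>s. f (Complex x s)) has_vector_derivative \<i> * deriv f (Complex x s)) (at s)" if "y < s" for s
          using that xy by (intro vd) auto
        show "continuous_on {y..1} (\<lambda>s. f (Complex x s))"
          using xy by (intro continuous_at_imp_continuous_on ballI has_vector_derivative_continuous[OF vd]) auto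
        show "continuous_on {y..1} (\<lambda>s. - 2 * B / sqrt s)"
          using xy by (intro continuous_intros) auto
        show "((\<lambda>s. - 2 * B / sqrt s) has_vector_derivative B / (s * sqrt s)) (at s)" if "y < s" for s
        proof -
          have "0 < s"
            using that xy by simp
          then have "((\<lambda>s. - 2 * B / sqrt s) has_real_derivative B / (s * sqrt s)) (at s)"
            by (auto intro!: derivative_eq_intros simp: field_simps)
          then show ?thesis
            by (simp add: has_real_derivative_iff_has_vector_derivative)
        qed
        show "norm (\<i> * deriv f (Complex x s)) \<le> B / (s * sqrt s)" if "y < s" "s < 1" for s
        proof -
          have "0 < s"
            using that xy by simp
          then have "norm (\<i> * deriv f (Complex x s)) \<le> B / s"
            using deriv_le[of "Complex x s"] that xy by (simp add: norm_mult)
          also have "\<dots> \<le> B / (s * sqrt s)"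
            using \<open>0 < s\<close> \<open>0 \<le> B\<close> that by (intro divide_left_mono) (auto simp: mult_le_cancel_left1)
          finally show ?thesis .
        qed
      qed
      then show ?thesis
        using \<open>0 \<le> B\<close> by simp
    qed
    note diff_le = this
    have C0_le: "C0 \<le> C0 / sqrt y"
      using sqrt \<open>0 \<le> C0\<close> by (simp add: pos_le_divide_eq mult_left_le)
    have "cmod (f (Complex x y)) \<le> cmod (f (Complex x 1)) + cmod (f (Complex x 1) - f (Complex x y))"
      using norm_triangle_sub[of "f (Complex x y)" "f (Complex x 1)"] by (simp add: norm_minus_commute)
    also have "\<dots> \<le> C0 / sqrt y + 2 * B / sqrt y"
      by (intro add_mono diff_le order_trans[OF C0[OF xy(1)] C0_le])
    finally have "cmod (f (Complex x y)) \<le> (C0 + 2 * B) / sqrt y"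
      by (simp add: add_divide_distrib)
    then show "cmod (f z) \<le> (C0 + 2 * B) / sqrt (Im z)"
      by (simp add: x_def y_def)
  qed
qed

text \<open>The singularity \<open>1 / sqrt (Im z)\<close> is integrable, so the primitive is
  Hoelder continuous with exponent 1/2 along vertical segments, with a constant that does not
  degenerate at the axis.\<close>

private lemma primitive_vertical_le:
  assumes F: "\<And>z. 0 < Im z \<Longrightarrow> (F has_field_derivative f z) (at z)" and "0 \<le> R"
  obtains C where "0 \<le> C"
    and "\<And>x y y'. \<bar>x\<bar> \<le> R \<Longrightarrow> 0 < y \<Longrightarrow> y \<le> y' \<Longrightarrow> y' \<le> 1 \<Longrightarrow>
      cmod (F (Complex x y') - F (Complex x y)) \<le> C * sqrt (y' - y)"
proof -
  obtain C where "0 \<le> C" and C: "\<And>z. \<bar>Re z\<bar> \<le> R \<Longrightarrow> 0 < Im z \<Longrightarrow> Im z \<le> 1 \<Longrightarrow> cmod (f z) \<le> C / sqrt (Im z)"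
    using f_le[OF \<open>0 \<le> R\<close>] by metis
  show ?thesis
  proof (rule that[of "2 * C"])
    show "0 \<le> 2 * C"
      using \<open>0 \<le> C\<close> by simp
    fix x y y' :: real
    assume x: "\<bar>x\<bar> \<le> R" and y: "0 < y" "y \<le> y'" "y' \<le> 1"
    show "cmod (F (Complex x y') - F (Complex x y)) \<le> 2 * C * sqrt (y' - y)"
    proof (cases "y = y'")
      case False
      then have "y < y'"
        using y by simp
      have "norm (F (Complex x y') - F (Complex x y)) \<le> 2 * C * sqrt y' - 2 * C * sqrt y"
      proof (rule differentiable_bound_general[OF \<open>y < y'\<close>])
        have vd: "((\<lambda>s. F (Complex x s)) has_vector_derivative \<i> * f (Complex x s)) (at s)" if "0 < s" for s
          using that by (intro vertical_derivative F) auto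
        show "((\<lambda>s. F (Complex x s)) has_vector_derivative \<i> * f (Complex x s)) (at s)" if "y < s" for s
          using that y by (intro vd) auto
        show "continuous_on {y..y'} (\<lambda>s. F (Complex x s))"
          using y by (intro continuous_at_imp_continuous_on ballI has_vector_derivative_continuous[OF vd]) auto
        show "continuous_on {y..y'} (\<lambda>s. 2 * C * sqrt s)"
          by (intro continuous_intros)
        show "((\<lambda>s. 2 * C * sqrt s) has_vector_derivative C / sqrt s) (at s)" if "y < s" for s
        proof -
          have "0 < s"
            using that y by simp
          then have "((\<lambda>s. 2 * C * sqrt s) has_real_derivative C / sqrt s) (at s)"
            by (auto intro!: derivative_eq_intros simp: field_simps)
          then show ?thesis
            by (simp add: has_real_derivative_iff_has_vector_derivative)
        qed
        show "norm (\<i> * f (Complex x s)) \<le> C / sqrt s" if "y < s" "s < y'" for s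
          using C[of "Complex x s"] that x y by (simp add: norm_mult)
      qed
      also have "\<dots> = 2 * C * (sqrt y' - sqrt y)"
        by (simp add: right_diff_distrib)
      also have "\<dots> \<le> 2 * C * sqrt (y' - y)"
        using sqrt_add_le_add_sqrt[of "y' - y" y] y \<open>0 \<le> C\<close> by (intro mult_left_mono) auto
      finally show ?thesis .
    qed simp
  qed
qed

text \<open>The horizontal derivative of \<open>Re F\<close> is \<open>Re f\<close>, which is
  uniformly small on segments close to the axis by uniform continuity of \<open>u\<close>; hence the
  increment of \<open>Re F\<close> vanishes in the limit.\<close>

private lemma primitive_Re_constant:
  assumes F: "\<And>z. 0 < Im z \<Longrightarrow> (F has_field_derivative f z) (at z)" and "x < x'"
    and lim: "\<And>t. (\<lambda>n. F (of_real t + \<i> / of_nat (Suc n))) \<longlonglongrightarrow> Fb t"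
  shows "Re (Fb x') = Re (Fb x)"
proof -
  have small: "\<bar>Re (Fb x') - Re (Fb x)\<bar> \<le> e * (x' - x)" if "e > 0" for e
  proof -
    define R where "R = \<bar>x\<bar> + \<bar>x'\<bar>"
    let ?K = "{z. \<bar>Re z\<bar> \<le> R \<and> 0 \<le> Im z \<and> Im z \<le> 1}"
    have "continuous_on ?K u"
      using u_continuous by (rule continuous_on_subset) auto
    moreover have "compact ?K"
      unfolding half_box_eq_cbox by (rule compact_cbox)
    ultimately have "uniformly_continuous_on ?K u"
      by (rule compact_uniformly_continuous)
    then obtain d where "d > 0" and d': "\<forall>z\<in>?K. \<forall>w\<in>?K. dist w z < d \<longrightarrow> dist (u w) (u z) < e"
      unfolding uniformly_continuous_on_def using \<open>e > 0\<close> by blast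
    have d: "dist (u w) (u z) < e" if "z \<in> ?K" "w \<in> ?K" "dist w z < d" for z w
      using d' that by blast
    have Re_f_small: "\<bar>Re (f (Complex t s))\<bar> < e" if "x \<le> t" "t \<le> x'" "0 < s" "s < d" "s \<le> 1" for s t
    proof -
      have "dist (u (Complex t s)) (u (Complex t 0)) < e"
      proof (rule d)
        show "Complex t 0 \<in> ?K" "Complex t s \<in> ?K"
          using that by (auto simp: R_def)
        show "dist (Complex t s) (Complex t 0) < d"
          using that by (simp add: dist_norm cmod_def)
      qed
      then show ?thesis
        using that by (simp add: u_def)
    qed
    have diff: "\<bar>Re (F (Complex x' s)) - Re (F (Complex x s))\<bar> \<le> e * (x' - x)" if "0 < s" "s < d" "s \<le> 1" for s
    proof -
      have hd: "((\<lambda>t. Re (F (Complex t s))) has_vector_derivative Re (f (Complex t s))) (at t)" for t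
        using \<open>0 < s\<close> horizontal_derivative[OF F[of "Complex t s"]]
        by (auto simp: has_vector_derivative_def intro!: derivative_eq_intros)
      have "norm (Re (F (Complex x' s)) - Re (F (Complex x s))) \<le> e * x' - e * x"
      proof (rule differentiable_bound_general[OF \<open>x < x'\<close>])
        show "((\<lambda>t. Re (F (Complex t s))) has_vector_derivative Re (f (Complex t s))) (at t)" for t
          by (rule hd)
        show "continuous_on {x..x'} (\<lambda>t. Re (F (Complex t s)))"
          by (intro continuous_at_imp_continuous_on ballI has_vector_derivative_continuous[OF hd])
        show "((\<lambda>t. e * t) has_vector_derivative e) (at t)" for t
          by (auto intro!: derivative_eq_intros)
        show "norm (Re (f (Complex t s))) \<le> e" if "x < t" "t < x'" for t
          using Re_f_small[of t s] that \<open>0 < s\<close> \<open>s < d\<close> \<open>s \<le> 1\<close> by simp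
      qed (intro continuous_intros)
      then show ?thesis
        by (simp add: right_diff_distrib)
    qed
    have "(\<lambda>n. \<bar>Re (F (of_real x' + \<i> / of_nat (Suc n))) - Re (F (of_real x + \<i> / of_nat (Suc n)))\<bar>)
        \<longlonglongrightarrow> \<bar>Re (Fb x') - Re (Fb x)\<bar>"
      by (intro tendsto_intros lim)
    moreover have "\<forall>\<^sub>F n in sequentially. 1 / real (Suc n) < d"
      using LIMSEQ_inverse_real_of_nat \<open>d > 0\<close> by (auto simp: order_tendsto_iff inverse_eq_divide)
    then have "\<forall>\<^sub>F n in sequentially.
        \<bar>Re (F (of_real x' + \<i> / of_nat (Suc n))) - Re (F (of_real x + \<i> / of_nat (Suc n)))\<bar> \<le> e * (x' - x)"
    proof eventually_elim
      case (elim n)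
      have "of_real t + \<i> / of_nat (Suc n) = Complex t (1 / real (Suc n))" for t
        by (simp add: Complex_eq)
      then show ?case
        using diff[of "1 / real (Suc n)"] elim by simp
    qed
    ultimately show ?thesis
      by (rule tendsto_upperbound) simp
  qed
  have "\<bar>Re (Fb x') - Re (Fb x)\<bar> \<le> 0"
  proof (rule field_le_epsilon)
    fix e :: real assume "e > 0"
    then show "\<bar>Re (Fb x') - Re (Fb x)\<bar> \<le> 0 + e"
      using small[of "e / (x' - x)"] \<open>x < x'\<close> by simp
  qed
  then show ?thesis
    by simp
qed

text \<open>\<open>f\<close> itself need not be known to extend continuously to the axis, but its primitive does,
  and the reflection principle is applied to the primitive.\<close>

private lemma primitive_extends:
  assumes F: "\<And>z. 0 < Im z \<Longrightarrow> (F has_field_derivative f z) (at z)"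
  obtains Fb where "continuous_on {z. 0 \<le> Im z} Fb" and "\<And>z. 0 < Im z \<Longrightarrow> Fb z = F z"
    and "\<And>z. 0 \<le> Im z \<Longrightarrow> (\<lambda>n. F (z + \<i> / of_nat (Suc n))) \<longlonglongrightarrow> Fb z"
proof -
  \<comment> \<open>The upward translates of \<open>F\<close> are continuous on the closed
    half-plane, and so is their locally uniform limit.\<close>
  define \<Phi> where "\<Phi> n z = F (z + \<i> / of_nat (Suc n))" for n z
  have \<Phi>_eq: "\<Phi> n = (\<lambda>z. F (z + \<i> / of_nat (Suc n)))" for n
    by (simp add: fun_eq_iff \<Phi>_def)
  define Fb where "Fb z = (if 0 < Im z then F z else lim (\<lambda>n. \<Phi> n z))" for z
  have F_cont: "isCont F z" if "0 < Im z" for z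
    using F[OF that] by (rule DERIV_isCont)
  have interior_lim: "(\<lambda>n. \<Phi> n z) \<longlonglongrightarrow> F z" if "0 < Im z" for z
    unfolding \<Phi>_def using F_cont[OF that] shift_up_LIMSEQ by (rule isCont_tendsto_compose)
  have local: "uniform_limit {z. \<bar>Re z\<bar> \<le> R \<and> 0 \<le> Im z \<and> Im z \<le> 1 / 2} \<Phi> Fb sequentially"
    if "0 \<le> R" for R
  proof -
    let ?K = "{z. \<bar>Re z\<bar> \<le> R \<and> 0 \<le> Im z \<and> Im z \<le> 1 / 2}"
    obtain C where "0 \<le> C" and C: "\<And>x y y'. \<bar>x\<bar> \<le> R \<Longrightarrow> 0 < y \<Longrightarrow> y \<le> y' \<Longrightarrow> y' \<le> 1 \<Longrightarrow>
      cmod (F (Complex x y') - F (Complex x y)) \<le> C * sqrt (y' - y)"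
      using primitive_vertical_le[OF F \<open>0 \<le> R\<close>] by metis
    have shift_eq: "z + \<i> / of_nat (Suc n) = Complex (Re z) (Im z + 1 / real (Suc n))" for z n
      by (simp add: complex_eq_iff)
    \<comment> \<open>\<open>1 \<le> m\<close> makes the shift at most 1/2, so that with
      \<open>Im z \<le> 1 / 2\<close> both points stay within height 1, where \<open>C\<close> is
      valid.\<close>
    have close: "cmod (\<Phi> m z - \<Phi> n z) \<le> C * sqrt (1 / real (Suc m))"
      if "z \<in> ?K" "1 \<le> m" "m \<le> n" for m n z
    proof -
      define a b where "a = 1 / real (Suc m)" and "b = 1 / real (Suc n)"
      have "0 < b" "b \<le> a" "a \<le> 1 / 2"
        using that by (auto simp: a_def b_def frac_le)
      then have "cmod (\<Phi> m z - \<Phi> n z) \<le> C * sqrt ((Im z + a) - (Im z + b))"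
        unfolding \<Phi>_def shift_eq a_def[symmetric] b_def[symmetric] using that by (intro C) auto
      also have "\<dots> \<le> C * sqrt a"
        using \<open>0 \<le> C\<close> \<open>0 < b\<close> by (intro mult_left_mono real_sqrt_le_mono) auto
      finally show ?thesis
        by (simp only: a_def)
    qed
    have "(\<lambda>m. C * sqrt (1 / real (Suc m))) \<longlonglongrightarrow> C * sqrt 0"
      using LIMSEQ_inverse_real_of_nat by (intro tendsto_intros) (simp add: inverse_eq_divide)
    then have to0: "(\<lambda>m. C * sqrt (1 / real (Suc m))) \<longlonglongrightarrow> 0"
      by simp
    have "uniformly_Cauchy_on ?K \<Phi>"
    proof (rule uniformly_Cauchy_onI)
      fix e :: real
      assume "e > 0"
      then have "\<forall>\<^sub>F m in sequentially. C * sqrt (1 / real (Suc m)) < e / 2"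
        using order_tendstoD(2)[OF to0, of "e / 2"] by simp
      then obtain N where N: "\<And>m. m \<ge> N \<Longrightarrow> C * sqrt (1 / real (Suc m)) < e / 2"
        by (auto simp: eventually_sequentially)
      define M where "M = max N 1"
      have "dist (\<Phi> m z) (\<Phi> n z) < e" if "z \<in> ?K" "M \<le> m" "M \<le> n" for z m n
      proof -
        have "cmod (\<Phi> M z - \<Phi> m z) < e / 2" "cmod (\<Phi> M z - \<Phi> n z) < e / 2"
          using close[of z M m] close[of z M n] N[of M] that by (auto simp: M_def)
        then show ?thesis
          using dist_triangle_half_r[of "\<Phi> M z" "\<Phi> m z" e "\<Phi> n z"] by (simp add: dist_norm)
      qed
      then show "\<exists>M. \<forall>x\<in>?K. \<forall>m\<ge>M. \<forall>n\<ge>M. dist (\<Phi> m x) (\<Phi> n x) < e"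
        by blast
    qed
    then have "uniformly_convergent_on ?K \<Phi>"
      by (rule Cauchy_uniformly_convergent)
    then obtain l where l: "uniform_limit ?K \<Phi> l sequentially"
      by (auto simp: uniformly_convergent_on_def)
    have "l z = Fb z" if "z \<in> ?K" for z
    proof -
      have "(\<lambda>n. \<Phi> n z) \<longlonglongrightarrow> l z"
        using tendsto_uniform_limitI[OF l that] .
      then show ?thesis
        using interior_lim[of z] LIMSEQ_unique by (auto simp: Fb_def limI)
    qed
    with l show ?thesis
      using uniform_limit_cong'[of ?K \<Phi> \<Phi> l Fb] by simp
  qed
  have boundary: "(\<lambda>n. \<Phi> n z) \<longlonglongrightarrow> Fb z" if "0 \<le> Im z" for z
  proof (cases "0 < Im z")
    case True
    then show ?thesis
      using interior_lim by (simp add: Fb_def)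
  next
    case False
    then show ?thesis
      using that by (intro tendsto_uniform_limitI[OF local[of "\<bar>Re z\<bar>"]]) auto
  qed
  have "continuous_on {z. 0 \<le> Im z} Fb"
    unfolding continuous_on_eq_continuous_within
  proof
    fix z :: complex
    assume z: "z \<in> {z. 0 \<le> Im z}"
    show "continuous (at z within {z. 0 \<le> Im z}) Fb"
    proof (cases "0 < Im z")
      case True
      have "\<forall>\<^sub>F w in nhds z. w \<in> {w. 0 < Im w}"
        using True open_halfspace_Im_gt by (intro eventually_nhds_in_open) auto
      then have "\<forall>\<^sub>F w in nhds z. F w = Fb w"
        by eventually_elim (simp add: Fb_def)
      then have "isCont Fb z"
        using F_cont[OF True] isCont_cong by fastforce
      then show ?thesis
        by (rule continuous_at_imp_continuous_at_within)
    next
      case False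
      define R where "R = \<bar>Re z\<bar> + 1"
      let ?K = "{z. \<bar>Re z\<bar> \<le> R \<and> 0 \<le> Im z \<and> Im z \<le> 1 / 2}"
      let ?U = "{w. \<bar>Re w\<bar> < R} \<inter> {w. Im w < 1 / 2}"
      have "continuous_on ?K Fb"
      proof (rule uniform_limit_theorem[OF _ local])
        show "\<forall>\<^sub>F n in sequentially. continuous_on ?K (\<Phi> n)"
        proof (intro always_eventually allI continuous_at_imp_continuous_on ballI)
          fix n w assume "w \<in> ?K"
          then have "0 < Im (w + \<i> / of_nat (Suc n))"
            by (simp add: add_nonneg_pos)
          then have "isCont F (w + \<i> / of_nat (Suc n))"
            by (rule F_cont)
          then show "isCont (\<Phi> n) w"
            unfolding \<Phi>_eq by (rule isCont_o2[rotated]) (intro continuous_intros)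
        qed
      qed (auto simp: R_def)
      moreover have "z \<in> ?K"
        using False z by (simp add: R_def)
      ultimately have "continuous (at z within ?K) Fb"
        by (simp add: continuous_on_eq_continuous_within)
      moreover have "at z within {z. 0 \<le> Im z} = at z within ?K"
      proof (rule at_within_nhd)
        show "open ?U"
          by (intro open_Int open_Collect_less continuous_intros)
        show "z \<in> ?U"
          using False z by (simp add: R_def)
      qed auto
      ultimately show ?thesis
        by simp
    qed
  qed
  then show ?thesis
    using that[of Fb] boundary by (simp add: \<Phi>_def Fb_def)
qed

text \<open>Schwarz reflection is applied to \<open>G\<close>, whose derivative is
  \<open>\<i> * f\<close>. The derivative of the reflected function, divided by \<open>\<i>\<close>,
  is the required extension; this division turns the symmetry \<open>Gr (cnj z) = cnj (Gr z)\<close>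
  into one with a minus sign.\<close>

proposition reflection_of_Re_vanishing:
  obtains g where "g holomorphic_on UNIV" and "\<And>z. 0 < Im z \<Longrightarrow> g z = f z"
    and "\<And>z. g (cnj z) = - cnj (g z)"
proof -
  obtain F where F': "\<And>z. z \<in> upper_half_plane \<Longrightarrow> (F has_field_derivative f z) (at z within upper_half_plane)"
    using holomorphic_convex_primitive'[OF convex_upper_half_plane open_upper_half_plane f_hol] by blast
  have F: "(F has_field_derivative f z) (at z)" if "0 < Im z" for z
    using F'[of z] at_within_open[OF _ open_upper_half_plane, of z] that
    by (simp add: upper_half_plane_def)
  obtain Fb where Fb_cont: "continuous_on {z. 0 \<le> Im z} Fb" and Fb_eq: "\<And>z. 0 < Im z \<Longrightarrow> Fb z = F z"
    and Fb_lim: "\<And>z. 0 \<le> Im z \<Longrightarrow> (\<lambda>n. F (z + \<i> / of_nat (Suc n))) \<longlonglongrightarrow> Fb z"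
    using primitive_extends[OF F] by metis
  have Re_Fb: "Re (Fb (of_real x)) = Re (Fb 0)" for x :: real
  proof (cases "x = 0")
    case False
    then consider "x < 0" | "0 < x"
      by linarith
    then show ?thesis
    proof cases
      case 1
      then show ?thesis
        using primitive_Re_constant[OF F, of x 0 "\<lambda>t. Fb (of_real t)"] Fb_lim by simp
    next
      case 2
      then show ?thesis
        using primitive_Re_constant[OF F, of 0 x "\<lambda>t. Fb (of_real t)"] Fb_lim by simp
    qed
  qed simp
  \<comment> \<open>On the axis \<open>Re Fb\<close> is constantly \<open>Re (Fb 0)\<close>, so the
    difference is purely imaginary there and the factor \<open>\<i>\<close> makes it real.\<close>
  define G where "G z = \<i> * (Fb z - of_real (Re (Fb 0)))" for z
  define Gr where "Gr z = (if 0 \<le> Im z then G z else cnj (G (cnj z)))" for z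
  have G_real: "G z \<in> \<real>" if "z \<in> \<real>" for z
    using Re_Fb[of "Re z"] of_real_Re[OF that] by (simp add: G_def complex_is_Real_iff)
  have G_deriv: "(G has_field_derivative \<i> * f z) (at z)" if "0 < Im z" for z
  proof -
    have "((\<lambda>z. \<i> * (F z - of_real (Re (Fb 0)))) has_field_derivative \<i> * f z) (at z)"
      using F[OF that] by (auto intro!: derivative_eq_intros)
    then show ?thesis
      using open_halfspace_Im_gt[of 0]
      by (rule has_field_derivative_transform_within_open) (use that in \<open>auto simp: G_def Fb_eq\<close>)
  qed
  have Gr_hol: "Gr holomorphic_on UNIV"
    unfolding Gr_def
  proof (rule Schwarz_reflection)
    show "G holomorphic_on UNIV \<inter> {z. 0 < Im z}"
      using G_deriv open_halfspace_Im_gt[of 0] by (auto simp: holomorphic_on_open)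
    show "continuous_on (UNIV \<inter> {z. 0 \<le> Im z}) G"
      unfolding G_def using Fb_cont by (auto intro!: continuous_intros)
  qed (use G_real in auto)
  have Gr_cnj: "Gr (cnj z) = cnj (Gr z)" for z
  proof -
    consider "0 < Im z" | "Im z < 0" | "Im z = 0"
      by linarith
    then show ?thesis
    proof cases
      case 3
      then have "z \<in> \<real>"
        by (simp add: complex_is_Real_iff)
      moreover have "cnj z = z"
        using 3 by (simp add: complex_eq_iff)
      ultimately show ?thesis
        using G_real[of z] 3 by (simp add: Gr_def Reals_cnj_iff)
    qed (auto simp: Gr_def)
  qed
  have Gr_deriv: "(Gr has_field_derivative deriv Gr z) (at z)" for z
    using holomorphic_derivI[OF Gr_hol open_UNIV] by simp
  have deriv_cnj: "deriv Gr (cnj z) = cnj (deriv Gr z)" for z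
  proof (rule DERIV_imp_deriv)
    have "cnj \<circ> Gr \<circ> cnj = Gr"
      using Gr_cnj by (simp add: fun_eq_iff)
    then show "(Gr has_field_derivative cnj (deriv Gr z)) (at (cnj z))"
      using has_field_derivative_cnj_cnj[of Gr "deriv Gr z" "cnj z"] Gr_deriv[of z] by simp
  qed
  show ?thesis
  proof
    show "(\<lambda>z. deriv Gr z / \<i>) holomorphic_on UNIV"
      using holomorphic_deriv[OF Gr_hol open_UNIV]
      by (intro holomorphic_on_divide holomorphic_on_const) auto
    show "deriv Gr z / \<i> = f z" if "0 < Im z" for z
    proof -
      have "(Gr has_field_derivative \<i> * f z) (at z)"
        using G_deriv[OF that] open_halfspace_Im_gt[of 0]
        by (rule has_field_derivative_transform_within_open) (use that in \<open>auto simp: Gr_def\<close>)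
      then show ?thesis
        by (simp add: DERIV_imp_deriv)
    qed
    show "deriv Gr (cnj z) / \<i> = - cnj (deriv Gr z / \<i>)" for z
      by (simp add: deriv_cnj)
  qed
qed

end

section \<open>The Schwarz integral\<close>

lemma
  shows inverse_1_plus_square_integrable: "integrable lborel (\<lambda>s::real. 1 / (1 + s\<^sup>2))"
    and inverse_1_plus_square_integral: "(LINT s::real|lborel. 1 / (1 + s\<^sup>2)) = pi"
proof -
  have "einterval (- \<infinity>) \<infinity> = UNIV"
    by (auto simp: einterval_def)
  then show "integrable lborel (\<lambda>s::real. 1 / (1 + s\<^sup>2))" "(LINT s::real|lborel. 1 / (1 + s\<^sup>2)) = pi"
    using integrable_inverse_1_plus_square LBINT_inverse_1_plus_square
    by (auto simp: set_integrable_def set_lebesgue_integral_def interval_lebesgue_integral_def inverse_eq_divide)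
qed

text \<open>The subtracted term is real and leaves the real part, a Poisson integral, unchanged; it
  improves the decay of the kernel to order 1/t^2, which matches the integrability of
  \<open>\<phi> t / (1 + t\<^sup>2)\<close>.\<close>

definition schwarz_integral :: "(real \<Rightarrow> real) \<Rightarrow> complex \<Rightarrow> complex" where
  "schwarz_integral \<phi> z = 1 / (of_real pi * \<i>) * (LINT t|lborel. of_real (\<phi> t) *
     (1 / (of_real t - z) - of_real t / ((of_real t)\<^sup>2 + 1)))"

context
  fixes \<phi> :: "real \<Rightarrow> real"
  assumes \<phi>_cont: "continuous_on UNIV \<phi>"
    and \<phi>_int: "integrable lborel (\<lambda>t. \<phi> t / (1 + t\<^sup>2))"
begin

private definition "mass = (LINT t|lborel. \<bar>\<phi> t\<bar> / (1 + t\<^sup>2))"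

private lemma \<phi>_meas [measurable]: "\<phi> \<in> borel_measurable borel"
  using \<phi>_cont by (rule borel_measurable_continuous_onI)

private lemma mass_int: "integrable lborel (\<lambda>t. \<bar>\<phi> t\<bar> / (1 + t\<^sup>2))"
  using integrable_abs[OF \<phi>_int] by (simp add: abs_divide)

private lemma integral_le_mass:
  fixes k :: "real \<Rightarrow> 'b :: {banach, second_countable_topology}"
  assumes meas: "k \<in> borel_measurable borel" and le: "\<And>t. norm (k t) \<le> B * (\<bar>\<phi> t\<bar> / (1 + t\<^sup>2))"
  shows "integrable lborel k" and "norm (LINT t|lborel. k t) \<le> B * mass"
proof -
  have int: "integrable lborel (\<lambda>t. B * (\<bar>\<phi> t\<bar> / (1 + t\<^sup>2)))"
    by (intro integrable_mult_right mass_int)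
  show k_int: "integrable lborel k"
  proof (rule Bochner_Integration.integrable_bound[OF int])
    show "k \<in> borel_measurable lborel"
      using meas by simp
    show "AE t in lborel. norm (k t) \<le> norm (B * (\<bar>\<phi> t\<bar> / (1 + t\<^sup>2)))"
      using order_trans[OF le abs_ge_self] by simp
  qed
  have "norm (LINT t|lborel. k t) \<le> (LINT t|lborel. B * (\<bar>\<phi> t\<bar> / (1 + t\<^sup>2)))"
    by (rule Bochner_Integration.integral_norm_bound_integral[OF k_int int le])
  then show "norm (LINT t|lborel. k t) \<le> B * mass"
    using mass_int by (simp add: mass_def del: times_divide_eq_right)
qed

private lemma cmod_diff_ge: "Im z \<le> cmod (of_real t - z)"
  using abs_Im_le_cmod[of "of_real t - z"] by simp

private lemma diff_nonzero: "0 < Im z \<Longrightarrow> of_real t - z \<noteq> 0"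
  by (auto simp: complex_eq_iff)

private lemma one_plus_square: "cmod (1 + (of_real t)\<^sup>2) = 1 + t\<^sup>2" "1 + (of_real t :: complex)\<^sup>2 \<noteq> 0"
proof -
  have "1 + (of_real t)\<^sup>2 = complex_of_real (1 + t\<^sup>2)"
    by simp
  moreover have "0 < 1 + t\<^sup>2"
    by (simp add: add_pos_nonneg)
  ultimately show "cmod (1 + (of_real t)\<^sup>2) = 1 + t\<^sup>2" "1 + (of_real t :: complex)\<^sup>2 \<noteq> 0"
    by (simp_all only: norm_of_real of_real_eq_0_iff)
qed

text \<open>Writing \<open>1 + t * z\<close> as \<open>(1 + z\<^sup>2) + z * (t - z)\<close> turns
  the kernel into \<open>((1 + z\<^sup>2) / (t - z) + z) / (1 + t\<^sup>2)\<close>, which displays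
  the weight; the rest is the distance \<open>Im z\<close> of \<open>z\<close> from the
  axis.\<close>

private lemma kernel_le:
  assumes "0 < Im z"
  shows "cmod (of_real (\<phi> t) * (1 / (of_real t - z) - of_real t / ((of_real t)\<^sup>2 + 1)))
     \<le> (cmod (1 + z\<^sup>2) / Im z + cmod z) * (\<bar>\<phi> t\<bar> / (1 + t\<^sup>2))"
proof -
  have eq: "1 / (of_real t - z) - of_real t / ((of_real t)\<^sup>2 + 1)
      = ((1 + z\<^sup>2) / (of_real t - z) + z) / (1 + (of_real t)\<^sup>2)"
    using diff_nonzero[OF assms, of t] one_plus_square(2)[of t]
    by (simp add: divide_simps add.commute[of _ 1]) (simp add: power2_eq_square algebra_simps)
  have "cmod ((1 + z\<^sup>2) / (of_real t - z) + z) \<le> cmod (1 + z\<^sup>2) / cmod (of_real t - z) + cmod z"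
    by (metis norm_divide norm_triangle_ineq)
  also have "\<dots> \<le> cmod (1 + z\<^sup>2) / Im z + cmod z"
    using cmod_diff_ge[of z t] assms by (intro add_right_mono divide_left_mono mult_pos_pos) auto
  finally have "cmod ((1 + z\<^sup>2) / (of_real t - z) + z) / (1 + t\<^sup>2) \<le> (cmod (1 + z\<^sup>2) / Im z + cmod z) / (1 + t\<^sup>2)"
    by (rule divide_right_mono) auto
  then have "\<bar>\<phi> t\<bar> * (cmod ((1 + z\<^sup>2) / (of_real t - z) + z) / (1 + t\<^sup>2))
      \<le> \<bar>\<phi> t\<bar> * ((cmod (1 + z\<^sup>2) / Im z + cmod z) / (1 + t\<^sup>2))"
    by (rule mult_left_mono) auto
  then show ?thesis
    unfolding eq norm_mult norm_divide[of "_ + z"] one_plus_square(1) norm_of_real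
    by (simp add: ac_simps)
qed

private lemma kernel_integrable:
  assumes "0 < Im z"
  shows "integrable lborel (\<lambda>t. of_real (\<phi> t) * (1 / (of_real t - z) - of_real t / ((of_real t)\<^sup>2 + 1)))"
  by (rule integral_le_mass(1)[OF _ kernel_le[OF assms]]) measurable

lemma schwarz_integral_le:
  assumes "0 < Im z"
  shows "cmod (schwarz_integral \<phi> z) \<le> (cmod (1 + z\<^sup>2) / Im z + cmod z) * mass"
proof -
  have "cmod (LINT t|lborel. of_real (\<phi> t) * (1 / (of_real t - z) - of_real t / ((of_real t)\<^sup>2 + 1)))
      \<le> (cmod (1 + z\<^sup>2) / Im z + cmod z) * mass" (is "cmod ?I \<le> _")
    by (rule integral_le_mass(2)[OF _ kernel_le[OF assms]]) measurable
  moreover have "cmod (schwarz_integral \<phi> z) = 1 / pi * cmod ?I"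
    by (simp add: schwarz_integral_def norm_mult norm_divide)
  moreover have "1 / pi * cmod ?I \<le> 1 * cmod ?I"
    using pi_gt3 by (intro mult_right_mono) auto
  ultimately show ?thesis
    by simp
qed

text \<open>States the bound without \<open>mass\<close>, which is private to the context.\<close>

lemma schwarz_integral_growth: "\<exists>I. \<forall>z. 0 < Im z \<longrightarrow>
    cmod (schwarz_integral \<phi> z) \<le> (cmod (1 + z\<^sup>2) / Im z + cmod z) * I"
  using schwarz_integral_le by blast

text \<open>Differentiation under the integral sign, done on difference quotients: the error is the
  integral of \<open>k\<close>, which carries an explicit factor \<open>w - z\<close> and is
  otherwise dominated uniformly for \<open>w\<close> near \<open>z\<close>.\<close>

lemma schwarz_integral_holomorphic: "schwarz_integral \<phi> holomorphic_on upper_half_plane"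
proof -
  define G :: "complex \<Rightarrow> complex" where "G z = (LINT t|lborel. of_real (\<phi> t) *
     (1 / (of_real t - z) - of_real t / ((of_real t)\<^sup>2 + 1)))" for z
  define D :: "complex \<Rightarrow> complex" where "D z = (LINT t|lborel. of_real (\<phi> t) * (1 / (of_real t - z)\<^sup>2))" for z
  have "(G has_field_derivative D z) (at z)" if "0 < Im z" for z
  proof -
    \<comment> \<open>Comes from squaring \<open>\<bar>t\<bar> \<le> cmod (t - z) + cmod z\<close>
      and absorbing the constants by means of
      \<open>1 \<le> (cmod (t - z))\<^sup>2 / (Im z)\<^sup>2\<close>.\<close>
    define N where "N = 2 + (1 + 2 * (cmod z)\<^sup>2) / (Im z)\<^sup>2"
    have "0 < N"
      unfolding N_def by (intro add_pos_nonneg divide_nonneg_nonneg) auto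
    have sq_ge: "1 + t\<^sup>2 \<le> N * (cmod (of_real t - z))\<^sup>2" for t
    proof -
      let ?d = "cmod (of_real t - z)"
      have "\<bar>t\<bar> \<le> ?d + cmod z"
        using norm_triangle_sub[of "of_real t" z] by simp
      then have "t\<^sup>2 \<le> (?d + cmod z)\<^sup>2"
        by (metis abs_ge_zero power2_abs power_mono)
      also have "\<dots> \<le> 2 * ?d\<^sup>2 + 2 * (cmod z)\<^sup>2"
        using sum_squares_bound[of ?d "cmod z"] by (simp add: power2_sum)
      finally have "1 + t\<^sup>2 \<le> 2 * ?d\<^sup>2 + (1 + 2 * (cmod z)\<^sup>2) * 1"
        by simp
      also have "\<dots> \<le> 2 * ?d\<^sup>2 + (1 + 2 * (cmod z)\<^sup>2) * (?d\<^sup>2 / (Im z)\<^sup>2)"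
        using power_mono[OF cmod_diff_ge[of z t], of 2] that
        by (intro add_left_mono mult_left_mono) auto
      also have "\<dots> = N * ?d\<^sup>2"
        by (simp add: N_def algebra_simps)
      finally show ?thesis .
    qed
    have inv_le: "1 / (cmod (of_real t - z))\<^sup>2 \<le> N / (1 + t\<^sup>2)" for t
    proof -
      have "0 < 1 + t\<^sup>2" "0 < (cmod (of_real t - z))\<^sup>2"
        using diff_nonzero[OF that, of t] by (auto simp: add_pos_nonneg)
      then show ?thesis
        using sq_ge[of t] by (simp add: field_simps)
    qed
    have D_int: "integrable lborel (\<lambda>t. of_real (\<phi> t) * (1 / (of_real t - z)\<^sup>2))"
    proof (rule integral_le_mass(1)[where B = N])
      show "cmod (of_real (\<phi> t) * (1 / (of_real t - z)\<^sup>2)) \<le> N * (\<bar>\<phi> t\<bar> / (1 + t\<^sup>2))" for t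
        using mult_left_mono[OF inv_le[of t] abs_ge_zero[of "\<phi> t"]]
        by (simp add: norm_mult norm_divide norm_power mult.commute)
    qed measurable
    have quotient: "cmod ((G w - G z) / (w - z) - D z) \<le> (2 / Im z * N * mass) * cmod (w - z)"
      if w: "w \<noteq> z" "cmod (w - z) < Im z / 2" for w
    proof -
      have Im_w: "Im z / 2 \<le> Im w"
        using abs_Im_le_cmod[of "w - z"] w by simp
      then have "0 < Im w"
        using \<open>0 < Im z\<close> by simp
      define k where "k t = of_real (\<phi> t) * ((w - z) / ((of_real t - w) * (of_real t - z)\<^sup>2))" for t
      have "(G w - G z) / (w - z) - D z
          = (LINT t|lborel. (of_real (\<phi> t) * (1 / (of_real t - w) - of_real t / ((of_real t)\<^sup>2 + 1))
              - of_real (\<phi> t) * (1 / (of_real t - z) - of_real t / ((of_real t)\<^sup>2 + 1))) / (w - z)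
              - of_real (\<phi> t) * (1 / (of_real t - z)\<^sup>2))"
        unfolding G_def D_def
        using kernel_integrable[OF \<open>0 < Im w\<close>] kernel_integrable[OF \<open>0 < Im z\<close>] D_int by simp
      also have "\<dots> = (LINT t|lborel. k t)"
      proof (rule Bochner_Integration.integral_cong[OF refl])
        fix t
        have "1 / (of_real t - w) - 1 / (of_real t - z) = (w - z) * (1 / ((of_real t - w) * (of_real t - z)))"
          using diff_nonzero[OF \<open>0 < Im w\<close>, of t] diff_nonzero[OF \<open>0 < Im z\<close>, of t] by (simp add: field_simps)
        then have "(1 / (of_real t - w) - 1 / (of_real t - z)) / (w - z) = 1 / ((of_real t - w) * (of_real t - z))"
          using w by simp
        moreover have "1 / ((of_real t - w) * (of_real t - z)) - 1 / (of_real t - z)\<^sup>2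
            = (w - z) / ((of_real t - w) * (of_real t - z)\<^sup>2)"
          using diff_nonzero[OF \<open>0 < Im w\<close>, of t] diff_nonzero[OF \<open>0 < Im z\<close>, of t]
          by (simp add: divide_simps power2_eq_square)
        ultimately show "(of_real (\<phi> t) * (1 / (of_real t - w) - of_real t / ((of_real t)\<^sup>2 + 1))
              - of_real (\<phi> t) * (1 / (of_real t - z) - of_real t / ((of_real t)\<^sup>2 + 1))) / (w - z)
              - of_real (\<phi> t) * (1 / (of_real t - z)\<^sup>2) = k t"
          unfolding k_def right_diff_distrib[symmetric] times_divide_eq_right[symmetric] by simp
      qed
      also have "cmod \<dots> \<le> (2 / Im z * N * cmod (w - z)) * mass"
      proof (rule integral_le_mass(2))
        fix t
        have "Im z / 2 \<le> cmod (of_real t - w)"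
          using cmod_diff_ge[of w t] Im_w by simp
        then have "1 / cmod (of_real t - w) \<le> 1 / (Im z / 2)"
          using \<open>0 < Im z\<close> by (intro divide_left_mono mult_pos_pos) auto
        then have "1 / cmod (of_real t - w) \<le> 2 / Im z"
          by simp
        then have "1 / cmod (of_real t - w) * (1 / (cmod (of_real t - z))\<^sup>2) \<le> 2 / Im z * (N / (1 + t\<^sup>2))"
          using \<open>0 < Im z\<close> by (intro mult_mono inv_le) auto
        then have "\<bar>\<phi> t\<bar> * cmod (w - z) * (1 / cmod (of_real t - w) * (1 / (cmod (of_real t - z))\<^sup>2))
            \<le> \<bar>\<phi> t\<bar> * cmod (w - z) * (2 / Im z * (N / (1 + t\<^sup>2)))"
          by (intro mult_left_mono) auto
        then show "cmod (k t) \<le> 2 / Im z * N * cmod (w - z) * (\<bar>\<phi> t\<bar> / (1 + t\<^sup>2))"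
          by (simp add: k_def norm_mult norm_divide norm_power ac_simps)
      next
        show "k \<in> borel_measurable borel"
          unfolding k_def by measurable
      qed
      finally show ?thesis
        by (simp add: ac_simps)
    qed
    have "((\<lambda>w. (G w - G z) / (w - z) - D z) \<longlongrightarrow> 0) (at z)"
    proof (rule Lim_null_comparison)
      have "\<forall>\<^sub>F w in at z. dist w z < Im z / 2"
        unfolding eventually_at using that by (intro exI[of _ "Im z / 2"]) auto
      moreover have "\<forall>\<^sub>F w in at z. w \<noteq> z"
        by (simp add: eventually_at_filter)
      ultimately show "\<forall>\<^sub>F w in at z. cmod ((G w - G z) / (w - z) - D z) \<le> (2 / Im z * N * mass) * cmod (w - z)"
        by eventually_elim (rule quotient; simp add: dist_norm)
      show "((\<lambda>w. (2 / Im z * N * mass) * cmod (w - z)) \<longlongrightarrow> 0) (at z)"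
        using \<open>0 < Im z\<close> by (auto intro!: tendsto_eq_intros)
    qed
    then have "((\<lambda>w. (G w - G z) / (w - z)) \<longlongrightarrow> D z) (at z)"
      by (simp add: LIM_zero_iff)
    then show ?thesis
      by (simp add: has_field_derivative_iff)
  qed
  then have "G holomorphic_on upper_half_plane"
    using open_upper_half_plane by (auto simp: holomorphic_on_open upper_half_plane_def)
  then show ?thesis
    unfolding schwarz_integral_def[abs_def] G_def[symmetric] by (intro holomorphic_intros) auto
qed

text \<open>The prefactor turns the imaginary part of the integral into the real part, and the
  imaginary part of \<open>1 / (t - z)\<close> is pi times the Poisson kernel.\<close>

private lemma Re_schwarz_integral:
  assumes "0 < Im z"
  shows "Re (schwarz_integral \<phi> z) = 1 / pi * (LINT t|lborel. \<phi> t * (Im z / ((t - Re z)\<^sup>2 + (Im z)\<^sup>2)))"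
proof -
  have "Re (1 / (of_real pi * \<i>) * w) = 1 / pi * Im w" for w
    by (simp add: Re_divide Im_divide power2_eq_square)
  then have "Re (schwarz_integral \<phi> z) = 1 / pi * (LINT t|lborel.
      Im (of_real (\<phi> t) * (1 / (of_real t - z) - of_real t / ((of_real t)\<^sup>2 + 1))))"
    unfolding schwarz_integral_def using kernel_integrable[OF assms] by (simp only: integral_Im)
  moreover have "Im (of_real (\<phi> t) * (1 / (of_real t - z) - of_real t / ((of_real t)\<^sup>2 + 1)))
      = \<phi> t * (Im z / ((t - Re z)\<^sup>2 + (Im z)\<^sup>2))" for t
  proof -
    have "of_real t / ((of_real t)\<^sup>2 + 1) = complex_of_real (t / (t\<^sup>2 + 1))"
      by simp
    then have "Im (of_real t / ((of_real t)\<^sup>2 + 1) :: complex) = 0"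
      by (simp only: Im_complex_of_real)
    then show ?thesis
      by (simp add: Im_divide)
  qed
  ultimately show ?thesis
    by simp
qed

text \<open>The Poisson kernel concentrates at \<open>x0\<close>. For the part of \<phi> within
  distance 1, which is bounded, the substitution \<open>t = x + y * s\<close> and dominated
  convergence give the limit; for the rest the kernel is at most a multiple of
  \<open>y / (1 + t\<^sup>2)\<close>, so its integral tends to 0.\<close>

lemma Re_schwarz_integral_boundary:
  "((\<lambda>z. Re (schwarz_integral \<phi> z)) \<longlongrightarrow> \<phi> x0) (at (of_real x0) within upper_half_plane)"
  unfolding tendsto_at_iff_sequentially
proof (intro allI impI)
  fix X
  assume X_in: "\<forall>n. X n \<in> upper_half_plane - {of_real x0}" and X_lim: "X \<longlonglongrightarrow> of_real x0"
  define x y where "x n = Re (X n)" and "y n = Im (X n)" for n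
  have y: "0 < y n" for n
    using X_in by (auto simp: y_def upper_half_plane_def)
  have x_lim: "x \<longlonglongrightarrow> x0" and y_lim: "y \<longlonglongrightarrow> 0"
    using tendsto_Re[OF X_lim] tendsto_Im[OF X_lim] by (simp_all add: x_def[abs_def] y_def[abs_def])
  \<comment> \<open>A sharp cut-off is harmless: the limit argument uses boundedness and continuity
    at \<open>x0\<close>, which lies in the interior.\<close>
  define near where "near t = (if \<bar>t - x0\<bar> \<le> 1 then \<phi> t else 0)" for t
  define far where "far t = (if \<bar>t - x0\<bar> \<le> 1 then 0 else \<phi> t)" for t
  have [measurable]: "near \<in> borel_measurable borel" "far \<in> borel_measurable borel"
    unfolding near_def far_def by measurable
  have "compact (\<phi> ` {x0 - 1..x0 + 1})"
    using \<phi>_cont by (intro compact_continuous_image) (auto intro: continuous_on_subset)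
  then obtain M where "0 < M" and M': "\<forall>v\<in>\<phi> ` {x0 - 1..x0 + 1}. norm v \<le> M"
    using compact_imp_bounded bounded_pos by metis
  have M: "\<bar>near t\<bar> \<le> M" for t
    using M' \<open>0 < M\<close> by (auto simp: near_def abs_le_iff)
  have "isCont near x0"
  proof -
    have "\<forall>\<^sub>F t in nhds x0. t \<in> ball x0 1"
      by (intro eventually_nhds_in_open) auto
    then have "\<forall>\<^sub>F t in nhds x0. near t = \<phi> t"
      by eventually_elim (auto simp: near_def dist_real_def)
    moreover have "isCont \<phi> x0"
      using \<phi>_cont by (simp add: continuous_on_eq_continuous_at)
    ultimately show ?thesis
      by (simp add: isCont_cong)
  qed
  have near_x0: "near x0 = \<phi> x0"
    by (simp add: near_def)
  have near_eq: "(LINT t|lborel. near t * (y n / ((t - x n)\<^sup>2 + (y n)\<^sup>2)))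
      = (LINT s|lborel. near (x n + y n * s) * (1 / (1 + s\<^sup>2)))" for n
  proof -
    have "(LINT t|lborel. near t * (y n / ((t - x n)\<^sup>2 + (y n)\<^sup>2)))
        = \<bar>y n\<bar> *\<^sub>R (LINT s|lborel. near (x n + y n * s) * (y n / ((x n + y n * s - x n)\<^sup>2 + (y n)\<^sup>2)))"
      using y[of n] by (intro lborel_integral_real_affine) simp
    also have "\<dots> = (LINT s|lborel. y n * (near (x n + y n * s) * (y n / ((x n + y n * s - x n)\<^sup>2 + (y n)\<^sup>2))))"
      using y[of n] by (simp only: integral_mult_right_zero real_scaleR_def abs_of_pos)
    also have "\<dots> = (LINT s|lborel. near (x n + y n * s) * (1 / (1 + s\<^sup>2)))"
    proof (rule Bochner_Integration.integral_cong[OF refl])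
      fix s
      have "(x n + y n * s - x n)\<^sup>2 + (y n)\<^sup>2 = y n * (y n * (1 + s\<^sup>2))"
        by (simp add: power2_eq_square algebra_simps)
      then have "y n * (y n / ((x n + y n * s - x n)\<^sup>2 + (y n)\<^sup>2)) = 1 / (1 + s\<^sup>2)"
        using y[of n] by simp
      then show "y n * (near (x n + y n * s) * (y n / ((x n + y n * s - x n)\<^sup>2 + (y n)\<^sup>2)))
          = near (x n + y n * s) * (1 / (1 + s\<^sup>2))"
        by (simp only: mult.left_commute[of "y n"])
    qed
    finally show ?thesis .
  qed
  have "(\<lambda>n. LINT s|lborel. near (x n + y n * s) * (1 / (1 + s\<^sup>2)))
      \<longlonglongrightarrow> (LINT s|lborel. \<phi> x0 * (1 / (1 + s\<^sup>2)))"
  proof (rule integral_dominated_convergence)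
    show "integrable lborel (\<lambda>s. M * (1 / (1 + s\<^sup>2)))"
      using inverse_1_plus_square_integrable by (rule integrable_mult_right)
    show "AE s in lborel. (\<lambda>n. near (x n + y n * s) * (1 / (1 + s\<^sup>2))) \<longlonglongrightarrow> \<phi> x0 * (1 / (1 + s\<^sup>2))"
    proof (rule AE_I2)
      fix s
      have "(\<lambda>n. x n + y n * s) \<longlonglongrightarrow> x0 + 0 * s"
        by (intro tendsto_intros x_lim y_lim)
      then have "(\<lambda>n. near (x n + y n * s)) \<longlonglongrightarrow> \<phi> x0"
        using isCont_tendsto_compose[OF \<open>isCont near x0\<close>] near_x0 by simp
      then show "(\<lambda>n. near (x n + y n * s) * (1 / (1 + s\<^sup>2))) \<longlonglongrightarrow> \<phi> x0 * (1 / (1 + s\<^sup>2))"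
        by (rule tendsto_mult_right)
    qed
    show "AE s in lborel. norm (near (x n + y n * s) * (1 / (1 + s\<^sup>2))) \<le> M * (1 / (1 + s\<^sup>2))" for n
    proof (rule AE_I2)
      fix s
      show "norm (near (x n + y n * s) * (1 / (1 + s\<^sup>2))) \<le> M * (1 / (1 + s\<^sup>2))"
        using mult_right_mono[OF M[of "x n + y n * s"], of "1 / (1 + s\<^sup>2)"]
        by (simp add: abs_mult)
    qed
  qed measurable
  then have near_lim: "(\<lambda>n. LINT t|lborel. near t * (y n / ((t - x n)\<^sup>2 + (y n)\<^sup>2))) \<longlonglongrightarrow> \<phi> x0 * pi"
    unfolding near_eq by (simp only: integral_mult_right_zero inverse_1_plus_square_integral)
  \<comment> \<open>The 4 comes from
    \<open>\<bar>t - x n\<bar> \<ge> \<bar>t - x0\<bar> / 2\<close>, valid for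
    \<open>\<bar>t - x0\<bar> > 1\<close> and \<open>\<bar>x n - x0\<bar> < 1 / 2\<close>; the
    bracket compares \<open>1 + t\<^sup>2\<close> with \<open>(t - x0)\<^sup>2\<close>.\<close>
  define N where "N = 4 * (3 + 2 * x0\<^sup>2)"
  have far_le: "norm (far t * (y n / ((t - x n)\<^sup>2 + (y n)\<^sup>2))) \<le> (y n * N) * (\<bar>\<phi> t\<bar> / (1 + t\<^sup>2))"
    if "\<bar>x n - x0\<bar> < 1 / 2" for n t
  proof (cases "\<bar>t - x0\<bar> \<le> 1")
    case True
    then show ?thesis
      using y[of n] by (simp add: far_def N_def)
  next
    case False
    define d where "d = \<bar>t - x0\<bar>"
    have "1 < d"
      using False by (simp add: d_def)
    have "d / 2 \<le> \<bar>t - x n\<bar>"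
      using abs_triangle_ineq[of "t - x n" "x n - x0"] that \<open>1 < d\<close> by (simp add: d_def)
    then have "(d / 2)\<^sup>2 \<le> \<bar>t - x n\<bar>\<^sup>2"
      using \<open>1 < d\<close> by (intro power_mono) auto
    then have "d\<^sup>2 \<le> 4 * (t - x n)\<^sup>2"
      by (simp add: power_divide mult.commute)
    also have "\<dots> \<le> 4 * ((t - x n)\<^sup>2 + (y n)\<^sup>2)"
      by simp
    finally have d_le: "d\<^sup>2 \<le> 4 * ((t - x n)\<^sup>2 + (y n)\<^sup>2)" .
    have "t\<^sup>2 \<le> 2 * d\<^sup>2 + 2 * x0\<^sup>2"
    proof -
      have "0 \<le> (t - x0 - x0)\<^sup>2"
        by simp
      then show ?thesis
        by (simp add: d_def power2_eq_square algebra_simps)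
    qed
    moreover have "1 \<le> d\<^sup>2"
      using \<open>1 < d\<close> by simp
    moreover from this have "2 * x0\<^sup>2 * 1 \<le> 2 * x0\<^sup>2 * d\<^sup>2"
      by (intro mult_left_mono) auto
    ultimately have "1 + t\<^sup>2 \<le> (3 + 2 * x0\<^sup>2) * d\<^sup>2"
      by (simp add: algebra_simps)
    also have "\<dots> \<le> (3 + 2 * x0\<^sup>2) * (4 * ((t - x n)\<^sup>2 + (y n)\<^sup>2))"
      using d_le by (intro mult_left_mono) auto
    finally have le: "1 + t\<^sup>2 \<le> N * ((t - x n)\<^sup>2 + (y n)\<^sup>2)"
      by (simp only: N_def mult.assoc mult.left_commute)
    have "0 < 1 + t\<^sup>2" "0 < (t - x n)\<^sup>2 + (y n)\<^sup>2"
      using y[of n] by (auto simp: add_pos_nonneg add_nonneg_pos)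
    then have "1 / ((t - x n)\<^sup>2 + (y n)\<^sup>2) \<le> N / (1 + t\<^sup>2)"
      using le by (simp add: pos_divide_le_eq pos_le_divide_eq mult.commute)
    then have le': "(\<bar>\<phi> t\<bar> * y n) * (1 / ((t - x n)\<^sup>2 + (y n)\<^sup>2)) \<le> (\<bar>\<phi> t\<bar> * y n) * (N / (1 + t\<^sup>2))"
      using y[of n] by (intro mult_left_mono) auto
    have "far t = \<phi> t"
      using False by (simp add: far_def)
    then have "norm (far t * (y n / ((t - x n)\<^sup>2 + (y n)\<^sup>2))) = (\<bar>\<phi> t\<bar> * y n) * (1 / ((t - x n)\<^sup>2 + (y n)\<^sup>2))"
      using y[of n] by (simp add: abs_mult)
    also note le'
    also have "(\<bar>\<phi> t\<bar> * y n) * (N / (1 + t\<^sup>2)) = (y n * N) * (\<bar>\<phi> t\<bar> / (1 + t\<^sup>2))"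
      by (simp add: ac_simps)
    finally show ?thesis .
  qed
  have close: "\<forall>\<^sub>F n in sequentially. \<bar>x n - x0\<bar> < 1 / 2"
    using tendstoD[OF x_lim, of "1 / 2"] by (simp add: dist_real_def)
  have far_meas: "(\<lambda>t. far t * (y n / ((t - x n)\<^sup>2 + (y n)\<^sup>2))) \<in> borel_measurable borel" for n
    by measurable
  have far_lim: "(\<lambda>n. LINT t|lborel. far t * (y n / ((t - x n)\<^sup>2 + (y n)\<^sup>2))) \<longlonglongrightarrow> 0"
  proof (rule Lim_null_comparison)
    show "\<forall>\<^sub>F n in sequentially. norm (LINT t|lborel. far t * (y n / ((t - x n)\<^sup>2 + (y n)\<^sup>2))) \<le> (y n * N) * mass"
      using close by eventually_elim (rule integral_le_mass(2)[OF far_meas far_le])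
    show "(\<lambda>n. y n * N * mass) \<longlonglongrightarrow> 0"
      using tendsto_mult_right[OF tendsto_mult_right[OF y_lim, of N], of mass] by simp
  qed
  have near_int: "integrable lborel (\<lambda>t. near t * (y n / ((t - x n)\<^sup>2 + (y n)\<^sup>2)))" for n
  proof (rule Bochner_Integration.integrable_bound)
    have "integrable lborel (\<lambda>t. M / y n * indicator {x0 - 1..x0 + 1} t)"
      by simp
    then show "integrable lborel (\<lambda>t. M / y n * indicator {x0 - 1..x0 + 1} t :: real)" .
    have kernel: "y n / ((t - x n)\<^sup>2 + (y n)\<^sup>2) \<le> 1 / y n" for t
    proof -
      have "y n / ((t - x n)\<^sup>2 + (y n)\<^sup>2) \<le> y n / (y n)\<^sup>2"
        using y[of n] by (intro divide_left_mono mult_pos_pos add_nonneg_pos) auto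
      then show ?thesis
        using y[of n] by (simp add: power2_eq_square)
    qed
    show "AE t in lborel. norm (near t * (y n / ((t - x n)\<^sup>2 + (y n)\<^sup>2)))
        \<le> norm (M / y n * indicator {x0 - 1..x0 + 1} t)"
    proof (rule AE_I2)
      fix t
      show "norm (near t * (y n / ((t - x n)\<^sup>2 + (y n)\<^sup>2))) \<le> norm (M / y n * indicator {x0 - 1..x0 + 1} t)"
      proof (cases "\<bar>t - x0\<bar> \<le> 1")
        case True
        have "\<bar>near t\<bar> * (y n / ((t - x n)\<^sup>2 + (y n)\<^sup>2)) \<le> M * (1 / y n)"
          using M kernel y[of n] \<open>0 < M\<close> by (intro mult_mono) auto
        moreover have "t \<in> {x0 - 1..x0 + 1}"
          using True by auto
        ultimately show ?thesis
          using y[of n] \<open>0 < M\<close> by (simp add: abs_mult)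
      qed (simp add: near_def)
    qed
  qed measurable
  have "\<forall>\<^sub>F n in sequentially. 1 / pi * ((LINT t|lborel. near t * (y n / ((t - x n)\<^sup>2 + (y n)\<^sup>2)))
      + (LINT t|lborel. far t * (y n / ((t - x n)\<^sup>2 + (y n)\<^sup>2)))) = ((\<lambda>z. Re (schwarz_integral \<phi> z)) \<circ> X) n"
    using close
  proof eventually_elim
    case (elim n)
    have "(LINT t|lborel. near t * (y n / ((t - x n)\<^sup>2 + (y n)\<^sup>2)))
        + (LINT t|lborel. far t * (y n / ((t - x n)\<^sup>2 + (y n)\<^sup>2)))
      = (LINT t|lborel. near t * (y n / ((t - x n)\<^sup>2 + (y n)\<^sup>2)) + far t * (y n / ((t - x n)\<^sup>2 + (y n)\<^sup>2)))"
      using near_int integral_le_mass(1)[OF far_meas far_le[OF elim]] by simp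
    also have "\<dots> = (LINT t|lborel. \<phi> t * (y n / ((t - x n)\<^sup>2 + (y n)\<^sup>2)))"
      by (intro Bochner_Integration.integral_cong) (auto simp: near_def far_def)
    finally show ?case
      using Re_schwarz_integral[of "X n"] y[of n] by (simp add: x_def y_def)
  qed
  moreover have "(\<lambda>n. 1 / pi * ((LINT t|lborel. near t * (y n / ((t - x n)\<^sup>2 + (y n)\<^sup>2)))
      + (LINT t|lborel. far t * (y n / ((t - x n)\<^sup>2 + (y n)\<^sup>2))))) \<longlonglongrightarrow> 1 / pi * (\<phi> x0 * pi + 0)"
    by (intro tendsto_intros near_lim far_lim)
  ultimately show "((\<lambda>z. Re (schwarz_integral \<phi> z)) \<circ> X) \<longlonglongrightarrow> \<phi> x0"
    using Lim_transform_eventually by fastforce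
qed

end

section \<open>The representation theorem\<close>

lemma closure_upper_half_plane: "closure upper_half_plane = {z. 0 \<le> Im z}"
proof
  show "closure upper_half_plane \<subseteq> {z. 0 \<le> Im z}"
    by (intro closure_minimal closed_halfspace_Im_ge) (auto simp: upper_half_plane_def)
  show "{z. 0 \<le> Im z} \<subseteq> closure upper_half_plane"
  proof
    fix z :: complex
    assume "z \<in> {z. 0 \<le> Im z}"
    then have "z + \<i> / of_nat (Suc n) \<in> upper_half_plane" for n
      by (simp add: upper_half_plane_def add_nonneg_pos)
    with shift_up_LIMSEQ[of z] show "z \<in> closure upper_half_plane"
      unfolding closure_sequential by (intro exI[of _ "\<lambda>n. z + \<i> / of_nat (Suc n)"] conjI allI)
  qed
qed

lemma cmod_le_exp_of_log_plus_le:
  assumes "log_plus (cmod w) \<le> u"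
  shows "cmod w \<le> exp u"
proof (cases "w = 0")
  case False
  have "ln (cmod w) \<le> u"
    using assms by (simp add: log_plus_def)
  then have "exp (ln (cmod w)) \<le> exp u"
    by simp
  then show ?thesis
    using False by simp
qed simp

text \<open>The quadratic term \<open>(e / 2 * q)\<^sup>2 / 2\<close> of the exponential series
  exceeds \<open>k * q\<close> as soon as \<open>q\<close> reaches \<open>8 * k / e\<^sup>2\<close>.
  This lets the Schwarz integral be absorbed into the growth bound.\<close>

lemma one_plus_linear_le_exp:
  assumes "0 < e" and "0 \<le> k" and "8 * k / e\<^sup>2 \<le> q" and "0 \<le> (q::real)"
  shows "1 + k * q \<le> exp (e / 2 * q)"
proof -
  have "8 * k \<le> q * e\<^sup>2"
    using assms by (simp add: pos_divide_le_eq)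
  then have "k * q \<le> q * e\<^sup>2 / 8 * q"
    using assms by (intro mult_right_mono) auto
  also have "\<dots> = (e / 2 * q)\<^sup>2 / 2"
    by (simp add: power2_eq_square)
  finally have "k * q \<le> (e / 2 * q)\<^sup>2 / 2" .
  moreover have "1 + e / 2 * q + (e / 2 * q)\<^sup>2 / 2 \<le> exp (e / 2 * q)"
    using assms by (intro exp_lower_Taylor_quadratic) auto
  moreover have "0 \<le> e / 2 * q"
    using assms by simp
  ultimately show ?thesis
    by linarith
qed

theorem proposition2p7:
  fixes h :: "complex \<Rightarrow> complex"
  assumes "h \<in> nevanlinna_class"
    and "continuous_on (closure upper_half_plane) h"
    and "integrable lborel (\<lambda>t::real. Re (h (of_real t)) / (1 + t\<^sup>2))"
    and "\<forall>t::real. Re (h (of_real (- t))) = Re (h (of_real t))"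
    and "bounded (h ` ({z. Re z = 0} \<inter> closure upper_half_plane))"
  shows "\<exists>\<alpha> \<beta> :: complex. \<forall>z\<in>upper_half_plane.
           h z = \<alpha> * z + \<beta> + 1 / (of_real pi * \<i>) *
             (LINT t|lborel. of_real (Re (h (of_real t))) *
                (1 / (of_real t - z) - of_real t / ((of_real t)\<^sup>2 + 1)))"
proof -
  define \<phi> where "\<phi> t = Re (h (of_real t))" for t :: real
  define g where "g = schwarz_integral \<phi>"
  have h_cont: "continuous_on {z. 0 \<le> Im z} h"
    using assms(2) by (simp add: closure_upper_half_plane)
  have "continuous_on UNIV (\<lambda>t::real. h (of_real t))"
    by (rule continuous_on_compose2[OF h_cont]) (auto intro: continuous_intros)
  then have \<phi>_cont: "continuous_on UNIV \<phi>"
    unfolding \<phi>_def by (intro continuous_intros)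
  have \<phi>_int: "integrable lborel (\<lambda>t. \<phi> t / (1 + t\<^sup>2))"
    using assms(3) by (simp add: \<phi>_def)
  note schwarz = schwarz_integral_holomorphic[OF \<phi>_cont \<phi>_int, folded g_def]
    schwarz_integral_growth[OF \<phi>_cont \<phi>_int, folded g_def]
    Re_schwarz_integral_boundary[OF \<phi>_cont \<phi>_int, folded g_def]
  obtain I where I: "\<And>z. 0 < Im z \<Longrightarrow> cmod (g z) \<le> (cmod (1 + z\<^sup>2) / Im z + cmod z) * I"
    using schwarz(2) by blast
  have "0 \<le> I"
  proof -
    have "0 \<le> (cmod (1 + \<i>\<^sup>2) / Im \<i> + cmod \<i>) * I"
      by (intro order_trans[OF norm_ge_zero I]) simp
    then show ?thesis
      by simp
  qed
  obtain u where h_hol: "h holomorphic_on upper_half_plane" and u: "harmonic_on u upper_half_plane"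
    and h_u: "\<And>z. z \<in> upper_half_plane \<Longrightarrow> log_plus (cmod (h z)) \<le> u z"
    using assms(1) unfolding nevanlinna_class_def by blast
  have "0 \<le> u z" if "z \<in> upper_half_plane" for z
    using h_u[OF that] by (simp add: log_plus_def)
  then obtain c where "0 \<le> c" and c: "\<And>e. e > 0 \<Longrightarrow> \<exists>R>0. \<forall>z\<in>upper_half_plane. R \<le> cmod z \<longrightarrow>
      u z \<le> c * Im z + e * (cmod z)\<^sup>2 / Im z"
    using nonneg_harmonic_growth[OF u] by metis
  have f_hol: "(\<lambda>z. h z - g z) holomorphic_on upper_half_plane"
    using h_hol schwarz(1) by (intro holomorphic_intros)
  \<comment> \<open>\<open>h\<close> is continuous up to the axis, while \<open>g\<close> is
    controlled there through its real part alone; hence the limit of a real part.\<close>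
  have f_lim: "((\<lambda>z. Re (h z - g z)) \<longlongrightarrow> 0) (at (of_real x) within upper_half_plane)" for x :: real
  proof -
    have "(h \<longlongrightarrow> h (of_real x)) (at (of_real x) within {z. 0 \<le> Im z})"
      using h_cont by (simp add: continuous_on_def)
    then have "(h \<longlongrightarrow> h (of_real x)) (at (of_real x) within upper_half_plane)"
      by (rule tendsto_within_subset) (auto simp: upper_half_plane_def)
    then have "((\<lambda>z. Re (h z)) \<longlongrightarrow> \<phi> x) (at (of_real x) within upper_half_plane)"
      unfolding \<phi>_def by (rule tendsto_Re)
    from tendsto_diff[OF this schwarz(3)[of x]] show ?thesis
      by simp
  qed
  obtain f where f_entire: "f holomorphic_on UNIV" and f_eq: "\<And>z. 0 < Im z \<Longrightarrow> f z = h z - g z"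
    and f_cnj: "\<And>z. f (cnj z) = - cnj (f z)"
    using reflection_of_Re_vanishing[OF f_hol f_lim] by metis
  have growth: "axis_growth f c"
    unfolding axis_growth_def
  proof (intro allI impI)
    fix e :: real
    assume "e > 0"
    then obtain R0 where "R0 > 0" and R0: "\<And>z. z \<in> upper_half_plane \<Longrightarrow> R0 \<le> cmod z \<Longrightarrow>
        u z \<le> c * Im z + e / 2 * (cmod z)\<^sup>2 / Im z"
      using c[of "e / 2"] by auto
    \<comment> \<open>Half of \<open>e\<close> is spent on \<open>u\<close>, the other half on
      absorbing \<open>g\<close>, whose bound is \<open>3 * I * q\<close>; the entry 1 serves
      \<open>cmod (1 + z\<^sup>2) \<le> 2 * (cmod z)\<^sup>2\<close>.\<close>
    define R where "R = max 1 (max R0 (8 * (3 * I) / e\<^sup>2))"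
    have upper: "cmod (f z) \<le> exp (c * Im z + e * (cmod z)\<^sup>2 / Im z)"
      if "R \<le> cmod z" "0 < Im z" for z
    proof -
      define q where "q = (cmod z)\<^sup>2 / Im z"
      have "1 \<le> cmod z" "R0 \<le> cmod z" "8 * (3 * I) / e\<^sup>2 \<le> cmod z"
        using that by (auto simp: R_def)
      have "Im z \<le> cmod z"
        using abs_Im_le_cmod[of z] by simp
      then have "cmod z * Im z \<le> (cmod z)\<^sup>2"
        by (simp add: power2_eq_square mult_left_mono)
      then have z_q: "cmod z \<le> q"
        using that by (simp add: q_def pos_le_divide_eq)
      have "1 \<le> (cmod z)\<^sup>2"
        using \<open>1 \<le> cmod z\<close> by simp
      then have "cmod (1 + z\<^sup>2) \<le> 2 * (cmod z)\<^sup>2"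
        using norm_triangle_ineq[of 1 "z\<^sup>2"] by (simp add: norm_power)
      then have "cmod (1 + z\<^sup>2) / Im z \<le> 2 * (cmod z)\<^sup>2 / Im z"
        using that by (intro divide_right_mono) auto
      then have "(cmod (1 + z\<^sup>2) / Im z + cmod z) * I \<le> (3 * q) * I"
        using z_q \<open>0 \<le> I\<close> by (intro mult_right_mono) (auto simp: q_def)
      then have g_le: "cmod (g z) \<le> 3 * I * q"
        using I[OF that(2)] by (simp add: mult.commute mult.left_commute)
      have in_uhp: "z \<in> upper_half_plane"
        using that by (simp add: upper_half_plane_def)
      have "0 \<le> u z"
        using h_u[OF in_uhp] by (simp add: log_plus_def)
      have "cmod (f z) \<le> cmod (h z) + cmod (g z)"
        unfolding f_eq[OF that(2)] by (rule norm_triangle_ineq4)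
      \<comment> \<open>Since \<open>u z \<ge> 0\<close>, the bound of \<open>g\<close> may be
        enlarged by \<open>exp (u z)\<close>, which then factors out of the sum.\<close>
      also have "\<dots> \<le> exp (u z) * 1 + exp (u z) * (3 * I * q)"
      proof (intro add_mono)
        show "cmod (h z) \<le> exp (u z) * 1"
          using cmod_le_exp_of_log_plus_le[OF h_u[OF in_uhp]] by simp
        have "1 * (3 * I * q) \<le> exp (u z) * (3 * I * q)"
          using \<open>0 \<le> u z\<close> order_trans[OF norm_ge_zero g_le] by (intro mult_right_mono) auto
        then show "cmod (g z) \<le> exp (u z) * (3 * I * q)"
          using g_le by simp
      qed
      also have "\<dots> = exp (u z) * (1 + 3 * I * q)"
        by (simp only: distrib_left)
      also have "\<dots> \<le> exp (u z) * exp (e / 2 * q)"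
      proof (intro mult_left_mono one_plus_linear_le_exp)
        show "8 * (3 * I) / e\<^sup>2 \<le> q" "0 \<le> q"
          using \<open>8 * (3 * I) / e\<^sup>2 \<le> cmod z\<close> z_q \<open>1 \<le> cmod z\<close> by linarith+
      qed (use \<open>e > 0\<close> \<open>0 \<le> I\<close> in auto)
      also have "\<dots> \<le> exp (c * Im z + e / 2 * q) * exp (e / 2 * q)"
        using R0[OF in_uhp \<open>R0 \<le> cmod z\<close>] by (intro mult_right_mono) (auto simp: q_def)
      also have "\<dots> = exp (c * Im z + e * q)"
        by (simp add: mult_exp_exp)
      finally show ?thesis
        by (simp add: q_def)
    qed
    show "\<exists>R. \<forall>z. R \<le> cmod z \<longrightarrow> Im z \<noteq> 0 \<longrightarrow>
        cmod (f z) \<le> exp (c * \<bar>Im z\<bar> + e * (cmod z)\<^sup>2 / \<bar>Im z\<bar>)"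
    proof (intro exI allI impI)
      fix z
      assume "R \<le> cmod z" "Im z \<noteq> 0"
      show "cmod (f z) \<le> exp (c * \<bar>Im z\<bar> + e * (cmod z)\<^sup>2 / \<bar>Im z\<bar>)"
      proof (cases "0 < Im z")
        case True
        then show ?thesis
          using upper[of z] \<open>R \<le> cmod z\<close> by simp
      next
        case False
        then have "cmod (f (cnj z)) \<le> exp (c * \<bar>Im z\<bar> + e * (cmod z)\<^sup>2 / \<bar>Im z\<bar>)"
          using upper[of "cnj z"] \<open>R \<le> cmod z\<close> \<open>Im z \<noteq> 0\<close> by simp
        then show ?thesis
          by (simp add: f_cnj)
      qed
    qed
  qed
  obtain H where H': "\<forall>v\<in>h ` ({z. Re z = 0} \<inter> closure upper_half_plane). cmod v \<le> H"
    using assms(5) bounded_iff by metis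
  have H: "cmod (h (\<i> * of_real y)) \<le> H" if "0 \<le> y" for y
    using H' that by (simp add: closure_upper_half_plane)
  have "0 \<le> H"
    using order_trans[OF norm_ge_zero H[of 0]] by simp
  have "compact (f ` cball 0 1)"
    using holomorphic_on_imp_continuous_on[OF f_entire]
    by (intro compact_continuous_image) (auto intro: continuous_on_subset)
  then obtain B where "0 < B" and B: "\<forall>v\<in>f ` cball 0 1. cmod v \<le> B"
    using compact_imp_bounded bounded_pos by metis
  \<comment> \<open>\<open>B\<close> covers the unit disc, where the estimate of \<open>g\<close>
    degenerates as \<open>y\<close> tends to 0. Beyond it
    \<open>cmod (1 + (\<i> * y)\<^sup>2) / y \<le> y\<close> yields \<open>2 * I * y\<close> for
    \<open>g\<close>, and \<open>H\<close> bounds \<open>h\<close>.\<close>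
  define M where "M = B + H + 2 * I"
  have upper_imag: "cmod (f (\<i> * of_real y)) \<le> M * (1 + \<bar>y\<bar>)" if "0 \<le> y" for y
  proof (cases "y \<le> 1")
    case True
    then have "cmod (f (\<i> * of_real y)) \<le> B * 1"
      using B that by (simp add: norm_mult)
    also have "\<dots> \<le> M * (1 + \<bar>y\<bar>)"
      using \<open>0 < B\<close> \<open>0 \<le> H\<close> \<open>0 \<le> I\<close> by (intro mult_mono) (auto simp: M_def)
    finally show ?thesis .
  next
    case False
    then have y: "1 < y"
      by simp
    have "1 + (\<i> * of_real y)\<^sup>2 = complex_of_real (1 - y\<^sup>2)"
      by (simp add: power_mult_distrib)
    then have "cmod (1 + (\<i> * of_real y)\<^sup>2) = \<bar>1 - y\<^sup>2\<bar>"
      by (simp only: norm_of_real)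
    also have "\<dots> \<le> y * y"
      using less_1_mult[OF y y] by (simp add: abs_le_iff power2_eq_square)
    finally have "cmod (1 + (\<i> * of_real y)\<^sup>2) / y \<le> y"
      using y by (simp add: pos_divide_le_eq)
    then have "(cmod (1 + (\<i> * of_real y)\<^sup>2) / Im (\<i> * of_real y) + cmod (\<i> * of_real y)) * I \<le> (2 * y) * I"
      using y \<open>0 \<le> I\<close> by (intro mult_right_mono) (auto simp: norm_mult)
    then have "cmod (g (\<i> * of_real y)) \<le> 2 * I * y"
      using I[of "\<i> * of_real y"] y by (simp add: mult.commute mult.left_commute)
    moreover have "cmod (f (\<i> * of_real y)) \<le> cmod (h (\<i> * of_real y)) + cmod (g (\<i> * of_real y))"
      using f_eq[of "\<i> * of_real y"] y norm_triangle_ineq4 by simp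
    ultimately have "cmod (f (\<i> * of_real y)) \<le> H + 2 * I * y"
      using H[of y] y by linarith
    also have "\<dots> \<le> (B + H) * (1 + y) + 2 * I * (1 + y)"
    proof (intro add_mono)
      have "H * 1 \<le> (B + H) * (1 + y)"
        using \<open>0 < B\<close> \<open>0 \<le> H\<close> y by (intro mult_mono) auto
      then show "H \<le> (B + H) * (1 + y)"
        by simp
      show "2 * I * y \<le> 2 * I * (1 + y)"
        using \<open>0 \<le> I\<close> by (intro mult_left_mono) auto
    qed
    also have "\<dots> = M * (1 + \<bar>y\<bar>)"
      using y by (simp add: M_def algebra_simps)
    finally show ?thesis .
  qed
  have imag: "cmod (f (\<i> * of_real y)) \<le> M * (1 + \<bar>y\<bar>)" for y
  proof (cases "0 \<le> y")
    case False
    have "cmod (f (\<i> * of_real y)) = cmod (f (cnj (\<i> * of_real y)))"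
      unfolding f_cnj by simp
    then show ?thesis
      using upper_imag[of "- y"] False by simp
  qed (rule upper_imag)
  obtain \<alpha> \<beta> where "\<And>z. f z = \<alpha> * z + \<beta>"
    using axis_growth_imp_linear[OF f_entire growth \<open>0 \<le> c\<close> imag] by metis
  then have "h z = \<alpha> * z + \<beta> + g z" if "z \<in> upper_half_plane" for z
    using f_eq[of z] that by (simp add: upper_half_plane_def algebra_simps)
  then show ?thesis
    unfolding g_def schwarz_integral_def \<phi>_def by blast
qed

end
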